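(* Let $T>0$, let $n\ge 1$ be an integer, let $\lambda:[0,T]\to(0,\infty)$ be continuous, and let $F$ be the cdf of a nonnegative random variable with mean $0<\mu<\infty$ and bounded density $f$. Suppose jobs arrive on $[0,T]$ according to a nonhomogeneous Poisson process with intensity $\lambda$, with job values i.i.d. from $F$ and independent of the arrival times. Let $r^\star := E_n(0; y_n,\ldots,y_1)$ be the expected reward of the optimal critical curves $y_1,\dots,y_n$ for $(\lambda,F)$. Let $\{\widetilde y^{(M)}_k\}_{k=1}^n$ be the critical curves computed by the NPSA algorithm from $M$ independent realisations of the job arrival process, and let $R^{(M)} := E_n(0;\widetilde y^{(M)}_n,\ldots,\widetilde y^{(M)}_1)$ be the random variable giving their expected reward under the true $(\lambda,F)$. Then, for every $\epsilon\in(0,1)$, $$\lim_{M\to\infty}\mathbb{P}\left[\frac{R^{(M)}}{r^\star}\ge 1-\epsilon\right]=1 .$$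
   Context: Mean shortage function: $\phi(y):=\int_y^\infty (x-y)f(x)\,dx$ for $y\ge 0$. Optimal critical curves: $y_1,\dots,y_n:[0,T]\to[0,\infty)$ are the unique solutions of $$\frac{dy_k(t)}{dt}=-\lambda(t)\big(\phi(y_k(t))-\phi(y_{k-1}(t))\big),\quad y_k(T)=0,\quad k=1,\dots,n,$$ with the convention $\phi(y_0(t))\equiv 0$ (i.e. $y_0\equiv\infty$). Reward functional: there are $n$ workers; when $k$ workers remain, a job arriving at time $t$ is accepted if and only if its value exceeds the $k$-th curve at $t$, yielding its value as reward and leaving $k-1$ workers. With $H(y):=\int_y^\infty x f(x)\,dx$ and $\overline F(y):=1-F(y)$, the expected reward collected on $[t,T]$ with $k$ workers using (not necessarily optimal) curves $z_k,\dots,z_1:[0,T]\to[0,\infty)$ is defined recursively by $E_0\equiv 0$ and $$E_k(t;z_k,\ldots,z_1)=\int_t^T\Big[H(z_k(\tau))+\overline F(z_k(\tau))\,E_{k-1}(\tau;z_{k-1},\ldots,z_1)\Big]\lambda(\tau)\exp\Big[-\int_t^\tau\lambda(\sigma)\overline F(z_k(\sigma))\,d\sigma\Big]d\tau .$$ NPSA algorithm. Each of the $M$ independent realisations is a list of pairs (job value, arrival time). (1) Intensity estimate: let $\delta_M=T\,M^{-1/3}$, $\ell(t)=\lfloor t/\delta_M\rfloor\,\delta_M$, and let $C_i(a,b)$ be the number of jobs arriving in $[a,b)$ in the $i$-th realisation. Then $\widetilde\lambda^{(M)}(t)=\frac{1}{M\delta_M}\sum_{i=1}^M C_i(\ell(t),\ell(t)+\delta_M)$.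 (2) Mean shortage estimate: pool all job values $x_1,\dots,x_N$ from the $M$ realisations ($N$ is their random total number), let $F_N(x)=\frac1N\sum_{i=1}^N \mathbf 1_{x_i\le x}$, and set $\widetilde\phi(y)=\int_y^\infty(1-F_N(x))\,dx$ for $y\ge0$ (and $\widetilde\phi\equiv0$ if $N=0$). (3) The curves $\widetilde y_k^{(M)}$, $k=1,\dots,n$, are the solutions (absolutely continuous, satisfying the equation off the finitely many discontinuities of $\widetilde\lambda^{(M)}$) of $$\frac{d\widetilde y_k(t)}{dt}=-\widetilde\lambda^{(M)}(t)\big(\widetilde\phi(\widetilde y_k(t))-\widetilde\phi(\widetilde y_{k-1}(t))\big),\quad \widetilde y_k(T)=0,\ t\in[0,T],$$ with the convention $\widetilde\phi(\widetilde y_0)\equiv0$ (i.e. $\widetilde y_0\equiv\infty$). *)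

theory Defs
  imports "HOL-Probability.Probability"
begin

definition mean_shortage :: "(real \<Rightarrow> real) \<Rightarrow> real \<Rightarrow> real" where
  "mean_shortage f y = (LINT x:{y..}|lborel. (x - y) * f x)"

definition tail_mean :: "(real \<Rightarrow> real) \<Rightarrow> real \<Rightarrow> real" where
  "tail_mean f y = (LINT x:{y..}|lborel. x * f x)"

(* Only the values y k t with 1 <= k <= n and t in {0..T} matter; y 0, which plays the role of
   infinity, is never evaluated.  At the end points of the interval the derivative is one-sided.
   No equation is required at the points of the exceptional set S. *)
definition solves_curve_equations ::
  "real \<Rightarrow> real set \<Rightarrow> (real \<Rightarrow> real) \<Rightarrow> (real \<Rightarrow> real) \<Rightarrow> nat \<Rightarrow> (nat \<Rightarrow> real \<Rightarrow> real) \<Rightarrow> bool"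
  where
  "solves_curve_equations T S lam \<phi> n y \<longleftrightarrow>
    (\<forall>k\<in>{1..n}. y k T = 0 \<and> (\<forall>t\<in>{0..T}. 0 \<le> y k t) \<and>
      (\<forall>t\<in>{0..T} - S.
        (y k has_real_derivative
          - lam t * (\<phi> (y k t) - (if k = 1 then 0 else \<phi> (y (k - 1) t)))) (at t within {0..T})))"

definition optimal_critical_curves ::
  "real \<Rightarrow> (real \<Rightarrow> real) \<Rightarrow> (real \<Rightarrow> real) \<Rightarrow> nat \<Rightarrow> (nat \<Rightarrow> real \<Rightarrow> real) \<Rightarrow> bool" where
  "optimal_critical_curves T lam f n y \<longleftrightarrow>
    solves_curve_equations T {} lam (mean_shortage f) n y"

primrec expected_reward ::
  "real \<Rightarrow> (real \<Rightarrow> real) \<Rightarrow> (real \<Rightarrow> real) \<Rightarrow> (real \<Rightarrow> real) \<Rightarrow> (nat \<Rightarrow> real \<Rightarrow> real) \<Rightarrow>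
    nat \<Rightarrow> real \<Rightarrow> real" where
  "expected_reward T lam F f z 0 = (\<lambda>t. 0)"
| "expected_reward T lam F f z (Suc k) = (\<lambda>t.
    LINT \<tau>:{t..T}|lborel.
      (tail_mean f (z (Suc k) \<tau>) + (1 - F (z (Suc k) \<tau>)) * expected_reward T lam F f z k \<tau>)
      * lam \<tau> * exp (- (LINT \<sigma>:{t..\<tau>}|lborel. lam \<sigma> * (1 - F (z (Suc k) \<sigma>)))))"

(* A realisation consists of the number K of jobs, their values X 0, ..., X (K - 1) and their
   arrival times A 0, ..., A (K - 1); the later entries of X and A are irrelevant padding. *)
definition job_list ::
  "('w \<Rightarrow> nat) \<Rightarrow> (nat \<Rightarrow> 'w \<Rightarrow> real) \<Rightarrow> (nat \<Rightarrow> 'w \<Rightarrow> real) \<Rightarrow> 'w \<Rightarrow> (real \<times> real) list" where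
  "job_list K X A \<omega> = map (\<lambda>j. (X j \<omega>, A j \<omega>)) [0..<K \<omega>]"

definition arrivals_in :: "real set \<Rightarrow> ('w \<Rightarrow> nat) \<Rightarrow> (nat \<Rightarrow> 'w \<Rightarrow> real) \<Rightarrow> 'w \<Rightarrow> nat" where
  "arrivals_in B K A \<omega> = card {j. j < K \<omega> \<and> A j \<omega> \<in> B}"

(* The Poisson law is spelled out because poisson_pmf is specified for positive rates only,
   whereas B may be a null set. *)
definition poisson_arrivals ::
  "'w measure \<Rightarrow> real \<Rightarrow> (real \<Rightarrow> real) \<Rightarrow> ('w \<Rightarrow> nat) \<Rightarrow> (nat \<Rightarrow> 'w \<Rightarrow> real) \<Rightarrow> bool" where
  "poisson_arrivals P T lam K A \<longleftrightarrow>
    (\<forall>\<omega>\<in>space P. \<forall>j<K \<omega>. A j \<omega> \<in> {0..T}) \<and>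
    (\<forall>B\<in>sets borel. B \<subseteq> {0..T} \<longrightarrow>
      (\<forall>m. \<P>(\<omega> in P. arrivals_in B K A \<omega> = m) =
        (LINT t:B|lborel. lam t) ^ m / fact m * exp (- (LINT t:B|lborel. lam t)))) \<and>
    (\<forall>m. \<forall>B :: nat \<Rightarrow> real set.
      (\<forall>i<m. B i \<in> sets borel \<and> B i \<subseteq> {0..T}) \<and> disjoint_family_on B {..<m} \<longrightarrow>
      prob_space.indep_vars P (\<lambda>_. count_space UNIV) (\<lambda>i. arrivals_in (B i) K A) {..<m})"

(* indep_var relates random variables of the same type only, hence the independence of the
   values from the arrival times is stated for the generated sigma-algebras. *)
definition job_arrival_process ::
  "'w measure \<Rightarrow> real \<Rightarrow> (real \<Rightarrow> real) \<Rightarrow> real measure \<Rightarrow>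
    ('w \<Rightarrow> nat) \<Rightarrow> (nat \<Rightarrow> 'w \<Rightarrow> real) \<Rightarrow> (nat \<Rightarrow> 'w \<Rightarrow> real) \<Rightarrow> bool" where
  "job_arrival_process P T lam D K X A \<longleftrightarrow>
    poisson_arrivals P T lam K A \<and>
    prob_space.indep_vars P (\<lambda>_. borel) X UNIV \<and>
    (\<forall>j. distr P borel (X j) = D) \<and>
    prob_space.indep_set P
      (sets (vimage_algebra (space P) (\<lambda>\<omega>. (K \<omega>, \<lambda>j. A j \<omega>))
        (count_space UNIV \<Otimes>\<^sub>M (\<Pi>\<^sub>M j\<in>UNIV. borel))))
      (sets (vimage_algebra (space P) (\<lambda>\<omega> j. X j \<omega>) (\<Pi>\<^sub>M j\<in>UNIV. borel)))"

definition independent_realisations ::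
  "'w measure \<Rightarrow> real \<Rightarrow> (real \<Rightarrow> real) \<Rightarrow> real measure \<Rightarrow> (nat \<Rightarrow> 'w \<Rightarrow> nat) \<Rightarrow>
    (nat \<Rightarrow> nat \<Rightarrow> 'w \<Rightarrow> real) \<Rightarrow> (nat \<Rightarrow> nat \<Rightarrow> 'w \<Rightarrow> real) \<Rightarrow> bool" where
  "independent_realisations P T lam D K X A \<longleftrightarrow>
    (\<forall>i. job_arrival_process P T lam D (K i) (X i) (A i)) \<and>
    prob_space.indep_vars P (\<lambda>_. count_space UNIV \<Otimes>\<^sub>M (\<Pi>\<^sub>M j\<in>UNIV. borel \<Otimes>\<^sub>M borel))
      (\<lambda>i \<omega>. (K i \<omega>, \<lambda>j. (X i j \<omega>, A i j \<omega>))) UNIV"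

definition bin_width :: "real \<Rightarrow> nat \<Rightarrow> real" where
  "bin_width T M = T * real M powr (- 1 / 3)"

definition bin_start :: "real \<Rightarrow> nat \<Rightarrow> real \<Rightarrow> real" where
  "bin_start T M t = of_int \<lfloor>t / bin_width T M\<rfloor> * bin_width T M"

definition arrival_count :: "real \<Rightarrow> real \<Rightarrow> (real \<times> real) list \<Rightarrow> nat" where
  "arrival_count a b r = length (filter (\<lambda>(x, s). a \<le> s \<and> s < b) r)"

definition intensity_estimate :: "real \<Rightarrow> (real \<times> real) list list \<Rightarrow> real \<Rightarrow> real" where
  "intensity_estimate T rs t =
    (let M = length rs; \<delta> = bin_width T M; a = bin_start T M t
     in 1 / (real M * \<delta>) * (\<Sum>i<M. real (arrival_count a (a + \<delta>) (rs ! i))))"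

definition pooled_values :: "(real \<times> real) list list \<Rightarrow> real list" where
  "pooled_values rs = map fst (concat rs)"

definition empirical_cdf :: "real list \<Rightarrow> real \<Rightarrow> real" where
  "empirical_cdf xs x = real (length (filter (\<lambda>v. v \<le> x) xs)) / real (length xs)"

definition mean_shortage_estimate :: "(real \<times> real) list list \<Rightarrow> real \<Rightarrow> real" where
  "mean_shortage_estimate rs y =
    (let xs = pooled_values rs
     in if xs = [] then 0 else (LINT x:{y..}|lborel. 1 - empirical_cdf xs x))"

definition absolutely_continuous_on_interval :: "real \<Rightarrow> real \<Rightarrow> (real \<Rightarrow> real) \<Rightarrow> bool" where
  "absolutely_continuous_on_interval a b g \<longleftrightarrow>
    (\<forall>\<epsilon>>0. \<exists>\<delta>>0. \<forall>I :: (real \<times> real) set.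
      finite I \<and> (\<forall>(u, v)\<in>I. a \<le> u \<and> u \<le> v \<and> v \<le> b) \<and>
      pairwise (\<lambda>p q. {fst p<..<snd p} \<inter> {fst q<..<snd q} = {}) I \<and>
      (\<Sum>(u, v)\<in>I. v - u) < \<delta>
      \<longrightarrow> (\<Sum>(u, v)\<in>I. \<bar>g v - g u\<bar>) < \<epsilon>)"

definition npsa_curves ::
  "real \<Rightarrow> (real \<times> real) list list \<Rightarrow> nat \<Rightarrow> (nat \<Rightarrow> real \<Rightarrow> real) \<Rightarrow> bool" where
  "npsa_curves T rs n y \<longleftrightarrow>
    (\<forall>k\<in>{1..n}. absolutely_continuous_on_interval 0 T (y k)) \<and>
    solves_curve_equations T
      {t\<in>{0..T}. \<not> continuous (at t within {0..T}) (intensity_estimate T rs)}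
      (intensity_estimate T rs) (mean_shortage_estimate rs) n y"

end

theory Submission
  imports Defs "HOL-Real_Asymp.Real_Asymp"
begin

text \<open>
  The curves solve a triangular system whose right-hand side is monotone in the unknown curve, so errors do not
  grow backwards in time: a perturbation of the data moves the \<open>k\<close>-th curve by at most the integrated
  discrepancy of the right-hand sides. It therefore suffices that, with high probability, the intensity estimate
  is close to the intensity in \<open>L\<^sup>1\<close> and the mean shortage estimate is uniformly close to the mean shortage
  function. The former follows from Chebyshev's inequality in each of the about \<open>M\<^sup>1\<^sup>/\<^sup>3\<close> bins and a union
  bound. For the latter, Wald's identity and truncation give a weak law of large numbers for the pooled values
  (only the mean is finite), and the common Lipschitz bound reduces uniform closeness to finitely many points.
  The expected reward is continuous under pointwise convergence of the curves by dominated convergence. The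
  stability bound also shows that the reward of the computed curves depends continuously on the data, hence
  that it is a random variable; otherwise the probability in the theorem would be a junk value.
\<close>

subsection \<open>Stability of the curve equations\<close>

text \<open>Two features of the data shape the argument: the estimated intensity has no bound valid
  for every sample, and the estimated mean shortage is a ratio with a random denominator. Because of
  the first, the stability estimate is asymmetric. A bounded intensity and an antitone, 1-Lipschitz
  shortage function are asked of a reference system only; the other system has to be close to it and
  to have a bounded shortage function. With the true problem as reference this yields convergence;
  with the algorithm's own equations at a fixed sample as reference it yields continuity in the
  data. Because of the second, numerator and denominator are both divided by the number M of
  realisations. Each is then an average of independent compound Poisson sums, with limits
  \<Lambda>\<phi>(y) and \<Lambda>, where \<Lambda> is the integral of the intensity. The width
  \<delta> = T M^(-1/3) meets two demands: it tends to 0, which removes the bias inside a bin, and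
  the failure probability of one bin, of order 1/(M \<delta>), adds up over about M^(1/3) bins to
  order M^(-1/3).\<close>

text \<open>From \<open>t\<close> up to the first later point \<open>r\<close> with
  \<open>u r \<le> 0\<close>, \<open>u\<close> is positive and \<open>u' \<ge> - g\<close>;
  integrating over \<open>{t..r}\<close> bounds \<open>u t\<close>. The lower bound is asked for
  only where \<open>u\<close> is positive, since only there does monotonicity of the shortage
  function have a favourable sign.\<close>

lemma backward_differential_inequality:
  fixes u u' g :: "real \<Rightarrow> real"
  assumes cont: "continuous_on {a..b} u" and S: "finite S" and ub: "u b \<le> 0"
    and deriv: "\<And>s. s \<in> {a..b} - S \<Longrightarrow> (u has_real_derivative u' s) (at s within {a..b})"
    and lower: "\<And>s. s \<in> {a..b} - S \<Longrightarrow> 0 < u s \<Longrightarrow> - g s \<le> u' s"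
    and g: "(g has_integral I) {a..b}" "\<And>s. s \<in> {a..b} \<Longrightarrow> 0 \<le> g s"
    and t: "t \<in> {a..b}"
  shows "u t \<le> I"
proof (cases "u t \<le> 0")
  case True
  moreover have "0 \<le> I" using has_integral_nonneg[OF g] by simp
  ultimately show ?thesis by simp
next
  case False
  \<comment> \<open>This set contains \<open>b\<close> and is compact, so its minimum
    \<open>r\<close> exists and \<open>u\<close> is positive on \<open>{t..<r}\<close>.\<close>
  let ?C = "{s \<in> {t..b}. u s \<le> 0}"
  have cont_t: "continuous_on {t..b} u" using cont by (rule continuous_on_subset) (use t in auto)
  have "closed ?C"
    using continuous_closed_preimage[OF cont_t, of "{..0}"] by (simp add: vimage_def Int_def)
  then have "compact ?C"
    using compact_Int_closed[of "{t..b}" ?C] by (simp add: Int_absorb1 subset_eq)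
  moreover have "?C \<noteq> {}" using ub t by auto
  ultimately obtain r where r: "r \<in> ?C" and min: "\<And>s. s \<in> ?C \<Longrightarrow> r \<le> s"
    using compact_attains_inf[of ?C] by metis
  \<comment> \<open>The comparison of integrals needs a pointwise bound everywhere, but nothing is
    known about \<open>u'\<close> at \<open>r\<close> and on \<open>S\<close>; changing it at
    finitely many points keeps the integral.\<close>
  define v where "v s = (if s \<in> insert r S then 0 else u' s)" for s
  have sub: "{t..r} \<subseteq> {a..b}" using r t by auto
  have "(u' has_integral (u r - u t)) {t..r}"
  proof (rule fundamental_theorem_of_calculus_interior_strong[OF S])
    show "t \<le> r" using r by simp
    show "continuous_on {t..r} u" using cont sub by (rule continuous_on_subset)
    show "(u has_vector_derivative u' s) (at s)" if "s \<in> {t<..<r} - S" for s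
      using deriv[of s] that sub at_within_Icc_at[of a s b] r t
      by (auto simp flip: has_real_derivative_iff_has_vector_derivative)
  qed
  then have v: "(v has_integral (u r - u t)) {t..r}"
    by (rule has_integral_spike_finite[where S = "insert r S", rotated 2]) (use S in \<open>auto simp: v_def\<close>)
  have gt: "g integrable_on {t..r}"
    using g(1) sub by (meson has_integral_integrable integrable_on_subinterval)
  have "((\<lambda>s. - g s) has_integral - integral {t..r} g) {t..r}"
    using gt by (intro has_integral_neg integrable_integral)
  then have "- integral {t..r} g \<le> u r - u t"
  proof (rule has_integral_le[OF _ v])
    fix s assume s: "s \<in> {t..r}"
    show "- g s \<le> v s"
    proof (cases "s \<in> insert r S")
      case True
      then show ?thesis using g(2)[of s] s sub by (auto simp: v_def)
    next
      case False
      then have "0 < u s" using min[of s] s r by fastforce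
      then show ?thesis using False lower[of s] s sub by (auto simp: v_def)
    qed
  qed
  moreover have "integral {t..r} g \<le> integral {a..b} g"
    using sub gt g by (intro integral_subset_le) auto
  moreover have "integral {a..b} g = I" using g(1) by (rule integral_unique)
  ultimately show ?thesis using r by simp
qed

text \<open>For u = y_k - z_k one has u' = - lam * (\<phi>(y_k) - \<phi>(z_k)) + remainder, and
  where u > 0 the first term is nonnegative because \<phi> is antitone. So only the remainder
  accumulates backwards from \<open>T\<close>, without any exponential growth. With A = C I + 2 L T
  \<eta> the errors obey e_k = A + (L T) e_(k-1), hence the geometric sum.\<close>

lemma curve_equations_stable:
  assumes T: "0 \<le> T"
    and y: "solves_curve_equations T S lam \<phi> n y" "\<And>k. k \<in> {1..n} \<Longrightarrow> continuous_on {0..T} (y k)"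
      "finite S"
    and z: "solves_curve_equations T S' lam' \<phi>' n z" "\<And>k. k \<in> {1..n} \<Longrightarrow> continuous_on {0..T} (z k)"
      "finite S'"
    and lam: "\<And>t. t \<in> {0..T} \<Longrightarrow> 0 \<le> lam t \<and> lam t \<le> L"
    and anti: "\<And>a b. 0 \<le> a \<Longrightarrow> a \<le> b \<Longrightarrow> \<phi> b \<le> \<phi> a"
    and lip: "\<And>a b. 0 \<le> a \<Longrightarrow> 0 \<le> b \<Longrightarrow> \<bar>\<phi> a - \<phi> b\<bar> \<le> \<bar>a - b\<bar>"
    and close: "\<And>a. 0 \<le> a \<Longrightarrow> \<bar>\<phi>' a - \<phi> a\<bar> \<le> \<eta>"
    and bound: "\<And>a. 0 \<le> a \<Longrightarrow> 0 \<le> \<phi>' a \<and> \<phi>' a \<le> C"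
    and g: "(g has_integral I) {0..T}" "\<And>t. t \<in> {0..T} \<Longrightarrow> \<bar>lam' t - lam t\<bar> \<le> g t"
    and k: "k \<in> {1..n}" and t: "t \<in> {0..T}"
  shows "\<bar>y k t - z k t\<bar> \<le> (C * I + 2 * (L * T) * \<eta>) * (\<Sum>j<k. (L * T) ^ j)"
  using k t
proof (induction k arbitrary: t)
  case 0
  then show ?case by simp
next
  case (Suc k)
  \<comment> \<open>The error already established for the preceding curve. It is the empty sum 0
    when the curve at hand is the first one, whose predecessor contributes 0 to both
    systems.\<close>
  define E where "E = (C * I + 2 * (L * T) * \<eta>) * (\<Sum>j<k. (L * T) ^ j)"
  have IH: "\<bar>y k s - z k s\<bar> \<le> E" if "k \<noteq> 0" "s \<in> {0..T}" for s
    using Suc.IH[of s] Suc.prems that unfolding E_def by auto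
  have C0: "0 \<le> C" using bound[of 0] by simp
  have L0: "0 \<le> L" using lam[of 0] T by fastforce
  have \<eta>0: "0 \<le> \<eta>" using close[of 0] by simp
  have I0: "0 \<le> I" using g by (intro has_integral_nonneg[OF g(1)]) (meson abs_ge_zero order_trans)
  have E0: "0 \<le> E"
    unfolding E_def using C0 I0 L0 T \<eta>0 by (intro mult_nonneg_nonneg add_nonneg_nonneg sum_nonneg) auto
  define G where "G s = g s * C + L * (2 * \<eta> + E)" for s
  have G: "(G has_integral I * C + L * (2 * \<eta> + E) * T) {0..T}"
    unfolding G_def[abs_def]
    using has_integral_add[OF has_integral_mult_left[OF g(1), of C]
        has_integral_const_real[of "L * (2 * \<eta> + E)" 0 T]] T by (simp add: mult.commute)
  have G0: "0 \<le> G s" if "s \<in> {0..T}" for s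
    unfolding G_def using g(2)[OF that] C0 L0 \<eta>0 E0
    by (intro add_nonneg_nonneg mult_nonneg_nonneg) auto
  let ?py = "\<lambda>s. if Suc k = 1 then 0 else \<phi> (y k s)" and ?pz = "\<lambda>s. if Suc k = 1 then 0 else \<phi>' (z k s)"
  define dy where "dy s = - lam s * (\<phi> (y (Suc k) s) - ?py s)" for s
  define dz where "dz s = - lam' s * (\<phi>' (z (Suc k) s) - ?pz s)" for s
  have nn: "0 \<le> y (Suc k) s" "0 \<le> z (Suc k) s" "k \<noteq> 0 \<Longrightarrow> 0 \<le> y k s" "k \<noteq> 0 \<Longrightarrow> 0 \<le> z k s"
    if "s \<in> {0..T}" for s
    using y(1) z(1) Suc.prems that by (auto simp: solves_curve_equations_def)
  have Dy: "(y (Suc k) has_real_derivative dy s) (at s within {0..T})"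
    if "s \<in> {0..T} - (S \<union> S')" for s
    using y(1) Suc.prems that unfolding solves_curve_equations_def dy_def by (auto dest!: bspec[where x = "Suc k"] simp del: mult_minus_left)
  have Dz: "(z (Suc k) has_real_derivative dz s) (at s within {0..T})"
    if "s \<in> {0..T} - (S \<union> S')" for s
    using z(1) Suc.prems that unfolding solves_curve_equations_def dz_def by (auto dest!: bspec[where x = "Suc k"] simp del: mult_minus_left)
  have rem: "\<bar>dy s - dz s + lam s * (\<phi> (y (Suc k) s) - \<phi> (z (Suc k) s))\<bar> \<le> G s"
    if s: "s \<in> {0..T}" for s
  proof -
    let ?b = "\<phi>' (z (Suc k) s) - ?pz s"
    let ?d = "\<phi>' (z (Suc k) s) - \<phi> (z (Suc k) s) - (?pz s - ?py s)"
    \<comment> \<open>The product difference is split so that the intensity error multiplies a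
      bounded factor of the second system, while the errors in \<phi> are multiplied by the bounded
      reference intensity.\<close>
    have eq: "dy s - dz s + lam s * (\<phi> (y (Suc k) s) - \<phi> (z (Suc k) s))
        = (lam' s - lam s) * ?b + lam s * ?d"
      unfolding dy_def dz_def by (simp add: algebra_simps)
    have "\<bar>?b\<bar> \<le> C" using bound[of "z (Suc k) s"] bound[of "z k s"] nn[OF s] by auto
    then have 1: "\<bar>(lam' s - lam s) * ?b\<bar> \<le> g s * C"
      unfolding abs_mult using g(2)[OF s] by (intro mult_mono) auto
    have "\<bar>?pz s - ?py s\<bar> \<le> \<eta> + E"
    proof (cases "k = 0")
      case False
      have "\<bar>\<phi>' (z k s) - \<phi> (y k s)\<bar> \<le> \<bar>\<phi>' (z k s) - \<phi> (z k s)\<bar> + \<bar>\<phi> (z k s) - \<phi> (y k s)\<bar>"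
        by simp
      also have "\<dots> \<le> \<eta> + \<bar>z k s - y k s\<bar>"
        using close lip nn(3,4)[OF s False] by (intro add_mono) auto
      also have "\<dots> \<le> \<eta> + E" using IH[OF False s] by simp
      finally show ?thesis using False by simp
    qed (use \<eta>0 E0 in auto)
    then have "\<bar>?d\<bar> \<le> 2 * \<eta> + E" using close[OF nn(2)[OF s]] by linarith
    then have "\<bar>lam s * ?d\<bar> \<le> L * (2 * \<eta> + E)"
      unfolding abs_mult using lam[OF s] by (intro mult_mono) auto
    with 1 show ?thesis unfolding eq G_def by linarith
  qed
  have end0: "y (Suc k) T = 0" "z (Suc k) T = 0"
    using y(1) z(1) Suc.prems by (auto simp: solves_curve_equations_def)
  have cont: "continuous_on {0..T} (y (Suc k))" "continuous_on {0..T} (z (Suc k))"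
    using y(2) z(2) Suc.prems by auto
  have fin: "finite (S \<union> S')" using y(3) z(3) by simp
  have sgn: "lam s * (\<phi> a - \<phi> b) \<le> 0" if "s \<in> {0..T}" "0 \<le> b" "b \<le> a" for s a b
    using lam[OF that(1)] anti[OF that(2,3)] by (intro mult_nonneg_nonpos) auto
  have "y (Suc k) t - z (Suc k) t \<le> I * C + L * (2 * \<eta> + E) * T"
  proof (rule backward_differential_inequality[where S = "S \<union> S'" and u = "\<lambda>s. y (Suc k) s - z (Suc k) s" and u' = "\<lambda>s. dy s - dz s", OF _ fin _ _ _ G])
    show "- G s \<le> dy s - dz s" if "s \<in> {0..T} - (S \<union> S')" "0 < y (Suc k) s - z (Suc k) s" for s
      using rem[of s] sgn[of s "z (Suc k) s" "y (Suc k) s"] nn[of s] that by fastforce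
  qed (use cont end0 Dy Dz G0 Suc.prems in \<open>auto intro!: continuous_intros derivative_intros\<close>)
  moreover have "z (Suc k) t - y (Suc k) t \<le> I * C + L * (2 * \<eta> + E) * T"
  proof (rule backward_differential_inequality[where S = "S \<union> S'" and u = "\<lambda>s. z (Suc k) s - y (Suc k) s" and u' = "\<lambda>s. dz s - dy s", OF _ fin _ _ _ G])
    show "- G s \<le> dz s - dy s" if "s \<in> {0..T} - (S \<union> S')" "0 < z (Suc k) s - y (Suc k) s" for s
      using rem[of s] sgn[of s "y (Suc k) s" "z (Suc k) s"] nn[of s] that
      by (auto simp: right_diff_distrib)
  qed (use cont end0 Dy Dz G0 Suc.prems in \<open>auto intro!: continuous_intros derivative_intros\<close>)
  moreover have "I * C + L * (2 * \<eta> + E) * T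
      = (C * I + 2 * (L * T) * \<eta>) * (\<Sum>j<Suc k. (L * T) ^ j)"
    unfolding sum.lessThan_Suc_shift E_def
    by (simp add: algebra_simps sum_distrib_left flip: sum_distrib_left)
  ultimately show ?case by linarith
qed

subsection \<open>Continuity of the expected reward\<close>

text \<open>From a start \<open>t \<ge> 0\<close> the recursion looks only at times in
  \<open>{0..T}\<close> and at curves of index 1 to \<open>k\<close>. This allows intensity and
  curves to be redefined elsewhere.\<close>

lemma expected_reward_cong:
  assumes "\<And>s. s \<in> {0..T} \<Longrightarrow> lam s = lam' s"
    and "\<And>i s. i \<in> {1..k} \<Longrightarrow> s \<in> {0..T} \<Longrightarrow> z i s = z' i s" and "0 \<le> t"
  shows "expected_reward T lam F f z k t = expected_reward T lam' F f z' k t"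
  using assms(2,3)
proof (induction k arbitrary: t)
  case 0
  then show ?case by simp
next
  case (Suc k)
  have inner: "(LINT \<sigma>:{t..\<tau>}|lborel. lam \<sigma> * (1 - F (z (Suc k) \<sigma>)))
      = (LINT \<sigma>:{t..\<tau>}|lborel. lam' \<sigma> * (1 - F (z' (Suc k) \<sigma>)))" if "\<tau> \<in> {t..T}" for \<tau>
    using assms(1) Suc.prems that by (intro set_lebesgue_integral_cong) auto
  have IH: "expected_reward T lam F f z k \<tau> = expected_reward T lam' F f z' k \<tau>" if "\<tau> \<in> {t..T}" for \<tau>
    using Suc that by auto
  show ?case
    using assms(1) Suc.prems
    by (auto intro!: set_lebesgue_integral_cong simp: inner IH)
qed

text \<open>The two bounds force \<open>lam\<close> to vanish off \<open>{0..T}\<close>, so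
  multiples of the indicator of \<open>{0..T}\<close> dominate all integrands, for every real start
  \<open>t\<close>. Density and cdf enter only through the analytic properties that the limit
  argument uses.\<close>

locale reward_setting =
  fixes T L \<mu> :: real and lam F f :: "real \<Rightarrow> real"
  assumes T_pos: "0 < T"
    and lam_meas [measurable]: "lam \<in> borel_measurable borel"
    and lam_nonneg: "0 \<le> lam t" and lam_le: "lam t \<le> L * indicator {0..T} t"
    and F_cont: "continuous_on UNIV F" and F_nonneg: "0 \<le> F x" and F_le: "F x \<le> 1"
    and H_cont: "continuous_on {0..} (tail_mean f)"
    and H_bound: "0 \<le> x \<Longrightarrow> 0 \<le> tail_mean f x \<and> tail_mean f x \<le> \<mu>"
begin

definition admissible :: "(nat \<Rightarrow> real \<Rightarrow> real) \<Rightarrow> bool" where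
  "admissible z \<longleftrightarrow> (\<forall>i. z i \<in> borel_measurable borel \<and> (\<forall>s. 0 \<le> z i s))"

abbreviation "R \<equiv> expected_reward T lam F f"

definition integrand :: "(nat \<Rightarrow> real \<Rightarrow> real) \<Rightarrow> nat \<Rightarrow> real \<Rightarrow> real \<Rightarrow> real" where
  "integrand z k t \<tau> = indicator {t..T} \<tau> * ((tail_mean f (z (Suc k) \<tau>) + (1 - F (z (Suc k) \<tau>)) * R z k \<tau>)
      * lam \<tau> * exp (- (LINT \<sigma>:{t..\<tau>}|lborel. lam \<sigma> * (1 - F (z (Suc k) \<sigma>)))))"

lemma R_Suc: "R z (Suc k) t = (LINT \<tau>|lborel. integrand z k t \<tau>)"
  by (simp add: set_lebesgue_integral_def integrand_def)

lemma L_nonneg: "0 \<le> L"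
  using lam_nonneg[of 0] lam_le[of 0] T_pos by simp

lemma integrable_bound_function: "integrable lborel (\<lambda>s. c * indicator {0..T} s :: real)"
  by (intro integrable_mult_right integrable_real_indicator) (auto simp: emeasure_lborel_Icc_eq)

lemma F_meas [measurable]: "F \<in> borel_measurable borel"
  using F_cont by (rule borel_measurable_continuous_onI)

lemma tail_meas:
  assumes [measurable]: "z \<in> borel_measurable borel" and "\<And>s. 0 \<le> z s"
  shows "(\<lambda>s. tail_mean f (z s)) \<in> borel_measurable borel"
proof -
  have "continuous_on UNIV (\<lambda>x. tail_mean f (max 0 x))"
    by (rule continuous_on_compose2[OF H_cont]) (auto intro!: continuous_intros)
  then have [measurable]: "(\<lambda>x. tail_mean f (max 0 x)) \<in> borel_measurable borel"
    by (rule borel_measurable_continuous_onI)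
  have "(\<lambda>s. tail_mean f (max 0 (z s))) \<in> borel_measurable borel" by measurable
  then show ?thesis using assms(2) by (simp add: max_absorb2)
qed

lemma inner_integrand_integrable:
  assumes [measurable]: "w \<in> borel_measurable borel"
  shows "integrable lborel (\<lambda>\<sigma>. indicator {t..\<tau>} \<sigma> * (lam \<sigma> * (1 - F (w \<sigma>))))"
proof (rule Bochner_Integration.integrable_bound[OF integrable_bound_function[of L]])
  show "AE \<sigma> in lborel. norm (indicator {t..\<tau>} \<sigma> * (lam \<sigma> * (1 - F (w \<sigma>)))) \<le> norm (L * indicator {0..T} \<sigma>)"
  proof (rule AE_I2)
    fix \<sigma>
    have "lam \<sigma> * (1 - F (w \<sigma>)) \<le> lam \<sigma> * 1"
      using lam_nonneg[of \<sigma>] F_nonneg[of "w \<sigma>"] by (intro mult_left_mono) auto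
    moreover have "0 \<le> lam \<sigma> * (1 - F (w \<sigma>))"
      using lam_nonneg[of \<sigma>] F_le[of "w \<sigma>"] by simp
    ultimately show "norm (indicator {t..\<tau>} \<sigma> * (lam \<sigma> * (1 - F (w \<sigma>)))) \<le> norm (L * indicator {0..T} \<sigma>)"
      using lam_nonneg[of \<sigma>] lam_le[of \<sigma>] by (auto simp: indicator_def)
  qed
qed (use integrable_bound_function[of "(\<mu> + c) * L"] in simp_all)

lemma inner_integral_bounds:
  assumes [measurable]: "w \<in> borel_measurable borel"
  shows "0 \<le> (LINT \<sigma>:{t..\<tau>}|lborel. lam \<sigma> * (1 - F (w \<sigma>)))"
    and "(LINT \<sigma>:{t..\<tau>}|lborel. lam \<sigma> * (1 - F (w \<sigma>))) \<le> L * T"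
proof -
  have b: "0 \<le> lam \<sigma> * (1 - F (w \<sigma>))" "lam \<sigma> * (1 - F (w \<sigma>)) \<le> L * indicator {0..T} \<sigma>" for \<sigma>
  proof -
    show "0 \<le> lam \<sigma> * (1 - F (w \<sigma>))" using lam_nonneg[of \<sigma>] F_le[of "w \<sigma>"] by simp
    have "lam \<sigma> * (1 - F (w \<sigma>)) \<le> lam \<sigma> * 1"
      using lam_nonneg[of \<sigma>] F_nonneg[of "w \<sigma>"] by (intro mult_left_mono) auto
    then show "lam \<sigma> * (1 - F (w \<sigma>)) \<le> L * indicator {0..T} \<sigma>" using lam_le[of \<sigma>] by simp
  qed
  show "0 \<le> (LINT \<sigma>:{t..\<tau>}|lborel. lam \<sigma> * (1 - F (w \<sigma>)))"
    using b by (auto simp: set_lebesgue_integral_def intro!: integral_nonneg_AE)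
  have "(LINT \<sigma>:{t..\<tau>}|lborel. lam \<sigma> * (1 - F (w \<sigma>))) \<le> (LINT \<sigma>|lborel. L * indicator {0..T} \<sigma>)"
    unfolding set_lebesgue_integral_def real_scaleR_def
  proof (rule integral_mono[OF inner_integrand_integrable])
    show "indicator {t..\<tau>} \<sigma> * (lam \<sigma> * (1 - F (w \<sigma>))) \<le> L * indicator {0..T} \<sigma>" for \<sigma>
      using b[of \<sigma>] by (cases "\<sigma> \<in> {t..\<tau>}") auto
  qed (use integrable_bound_function[of L] in simp_all)
  also have "\<dots> = L * T" using T_pos by simp
  finally show "(LINT \<sigma>:{t..\<tau>}|lborel. lam \<sigma> * (1 - F (w \<sigma>))) \<le> L * T" .
qed

lemma integrand_bounds:
  assumes z: "admissible z" and c: "\<And>t. 0 \<le> R z k t \<and> R z k t \<le> c"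
  shows "0 \<le> integrand z k t \<tau>" "integrand z k t \<tau> \<le> (\<mu> + c) * L * indicator {0..T} \<tau>"
proof -
  let ?a = "tail_mean f (z (Suc k) \<tau>) + (1 - F (z (Suc k) \<tau>)) * R z k \<tau>"
  let ?e = "exp (- (LINT \<sigma>:{t..\<tau>}|lborel. lam \<sigma> * (1 - F (z (Suc k) \<sigma>))))"
  have zm [measurable]: "z i \<in> borel_measurable borel" and z0: "0 \<le> z i s" for i s
    using z by (auto simp: admissible_def)
  note H = H_bound[OF z0, of "Suc k" \<tau>]
  have a: "0 \<le> ?a" using H c[of \<tau>] F_le[of "z (Suc k) \<tau>"] by simp
  have "(1 - F (z (Suc k) \<tau>)) * R z k \<tau> \<le> 1 * R z k \<tau>"
    using c[of \<tau>] F_nonneg[of "z (Suc k) \<tau>"] by (intro mult_right_mono) auto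
  then have a': "?a \<le> \<mu> + c" using H c[of \<tau>] by simp
  have e: "?e \<le> 1" using inner_integral_bounds(1)[OF zm, of t \<tau> "Suc k"] by simp
  show "0 \<le> integrand z k t \<tau>" using a lam_nonneg[of \<tau>] by (simp add: integrand_def)
  have "?a * lam \<tau> * ?e \<le> ((\<mu> + c) * (L * indicator {0..T} \<tau>)) * 1"
    using a a' e lam_nonneg[of \<tau>] lam_le[of \<tau>] L_nonneg
    by (intro mult_mono mult_nonneg_nonneg) auto
  moreover have "0 \<le> ?a * lam \<tau> * ?e" using a lam_nonneg[of \<tau>] by simp
  ultimately show "integrand z k t \<tau> \<le> (\<mu> + c) * L * indicator {0..T} \<tau>"
    by (cases "\<tau> \<in> {t..T}") (auto simp: integrand_def mult.assoc)
qed

lemma integrand_meas: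
  assumes z: "admissible z" and [measurable]: "R z k \<in> borel_measurable borel"
  shows "(\<lambda>(t, \<tau>). integrand z k t \<tau>) \<in> borel_measurable (borel \<Otimes>\<^sub>M lborel)"
proof -
  have zm [measurable]: "z i \<in> borel_measurable borel" for i using z by (auto simp: admissible_def)
  have [measurable]: "(\<lambda>s. tail_mean f (z (Suc k) s)) \<in> borel_measurable borel"
    using z by (intro tail_meas) (auto simp: admissible_def)
  have ind: "indicator {a..b} x = (if a \<le> x \<and> x \<le> b then 1 else 0::real)" for a b x :: real by simp
  show ?thesis
    unfolding integrand_def set_lebesgue_integral_def ind by measurable
qed

text \<open>The constant \<open>c\<close> is chosen before \<open>z\<close> and \<open>t\<close>: it
  is obtained recursively from \<mu>, \<open>L\<close> and \<open>T\<close>. This uniformity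
  supplies one majorant for a whole sequence of curves.\<close>

lemma R_bounded_measurable:
  "\<exists>c. \<forall>z. admissible z \<longrightarrow> R z k \<in> borel_measurable borel \<and> (\<forall>t. 0 \<le> R z k t \<and> R z k t \<le> c)"
proof (induction k)
  case 0
  then show ?case by (auto intro!: exI[of _ 0])
next
  case (Suc k)
  then obtain c where c: "\<And>z. admissible z \<Longrightarrow> R z k \<in> borel_measurable borel"
    "\<And>z t. admissible z \<Longrightarrow> 0 \<le> R z k t \<and> R z k t \<le> c" by metis
  show ?case
  proof (intro exI allI impI conjI)
    fix z assume z: "admissible z"
    note [measurable] = integrand_meas[OF z c(1)[OF z]]
    show "R z (Suc k) \<in> borel_measurable borel"
      unfolding R_Suc[abs_def] by measurable
    fix t
    show "0 \<le> R z (Suc k) t"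
      unfolding R_Suc using integrand_bounds(1)[OF z c(2)[OF z]] by (intro integral_nonneg_AE) auto
    show "R z (Suc k) t \<le> (LINT \<tau>|lborel. (\<mu> + c) * L * indicator {0..T} \<tau>)"
      unfolding R_Suc using integrand_bounds[OF z c(2)[OF z]]
      by (intro integral_mono_AE' integrable_bound_function AE_I2) (meson order_trans)+
  qed
qed

text \<open>Induction on the number of workers, with dominated convergence twice per level: once for
  the integral in the exponent and once for the outer integral.\<close>

lemma R_tendsto:
  assumes z: "\<And>m::nat. admissible (z m)" "admissible z'"
    and lim: "\<And>i s. i \<in> {1..k} \<Longrightarrow> (\<lambda>m. z m i s) \<longlonglongrightarrow> z' i s"
  shows "(\<lambda>m. R (z m) k t) \<longlonglongrightarrow> R z' k t"
  using lim
proof (induction k arbitrary: t)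
  case 0
  then show ?case by simp
next
  case (Suc k)
  obtain c where c: "\<And>z. admissible z \<Longrightarrow> R z k \<in> borel_measurable borel"
    "\<And>z t. admissible z \<Longrightarrow> 0 \<le> R z k t \<and> R z k t \<le> c" using R_bounded_measurable by metis
  have IH: "(\<lambda>m. R (z m) k t) \<longlonglongrightarrow> R z' k t" for t using Suc by simp
  have zk: "(\<lambda>m. z m (Suc k) s) \<longlonglongrightarrow> z' (Suc k) s" for s using Suc.prems by simp
  have Fl: "(\<lambda>m. F (z m (Suc k) s)) \<longlonglongrightarrow> F (z' (Suc k) s)" for s
    using continuous_on_tendsto_compose[OF F_cont zk] by simp
  have Hl: "(\<lambda>m. tail_mean f (z m (Suc k) s)) \<longlonglongrightarrow> tail_mean f (z' (Suc k) s)" for s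
    using z by (intro continuous_on_tendsto_compose[OF H_cont zk]) (auto simp: admissible_def)
  have [measurable]: "z m i \<in> borel_measurable borel" "z' i \<in> borel_measurable borel" for m i
    using z by (auto simp: admissible_def)
  have inner: "(\<lambda>m. LINT \<sigma>:{t..\<tau>}|lborel. lam \<sigma> * (1 - F (z m (Suc k) \<sigma>)))
      \<longlonglongrightarrow> (LINT \<sigma>:{t..\<tau>}|lborel. lam \<sigma> * (1 - F (z' (Suc k) \<sigma>)))" for \<tau>
    unfolding set_lebesgue_integral_def real_scaleR_def
  proof (rule integral_dominated_convergence[where w = "\<lambda>\<sigma>. L * indicator {0..T} \<sigma>"])
    show "AE \<sigma> in lborel. norm (indicator {t..\<tau>} \<sigma> * (lam \<sigma> * (1 - F (z m (Suc k) \<sigma>)))) \<le> L * indicator {0..T} \<sigma>" for m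
    proof (rule AE_I2)
      fix \<sigma>
      have "lam \<sigma> * (1 - F (z m (Suc k) \<sigma>)) \<le> lam \<sigma> * 1"
        using lam_nonneg[of \<sigma>] F_nonneg[of "z m (Suc k) \<sigma>"] by (intro mult_left_mono) auto
      moreover have "0 \<le> lam \<sigma> * (1 - F (z m (Suc k) \<sigma>))"
        using lam_nonneg[of \<sigma>] F_le[of "z m (Suc k) \<sigma>"] by simp
      ultimately show "norm (indicator {t..\<tau>} \<sigma> * (lam \<sigma> * (1 - F (z m (Suc k) \<sigma>)))) \<le> L * indicator {0..T} \<sigma>"
        using lam_nonneg[of \<sigma>] lam_le[of \<sigma>] by (cases "\<sigma> \<in> {t..\<tau>}") auto
    qed
  qed (use integrable_bound_function[of L] in \<open>simp_all, auto intro!: AE_I2 tendsto_intros Fl\<close>)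
  show ?case
    unfolding R_Suc
  proof (rule integral_dominated_convergence[where w = "\<lambda>\<tau>. (\<mu> + c) * L * indicator {0..T} \<tau>"])
    show "AE \<tau> in lborel. (\<lambda>m. integrand (z m) k t \<tau>) \<longlonglongrightarrow> integrand z' k t \<tau>"
      unfolding integrand_def by (intro AE_I2 tendsto_intros IH Fl Hl inner)
    show "AE \<tau> in lborel. norm (integrand (z m) k t \<tau>) \<le> (\<mu> + c) * L * indicator {0..T} \<tau>" for m
      using integrand_bounds[OF z(1) c(2)[OF z(1)]] by auto
    show "integrand (z m) k t \<in> borel_measurable lborel" for m
      using measurable_Pair2[OF integrand_meas[OF z(1) c(1)[OF z(1)]], of t] by simp
    show "integrand z' k t \<in> borel_measurable lborel"
      using measurable_Pair2[OF integrand_meas[OF z(2) c(1)[OF z(2)]], of t] by simp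
  qed (use integrable_bound_function[of "(\<mu> + c) * L"] in simp_all)
qed

text \<open>At \<open>T\<close> the curve is 0, so near the horizon jobs are accepted generously and
  earn about H(0) > 0 at a positive rate. A continuous nonnegative minorant that is positive at
  \<open>T\<close> has a positive integral.\<close>

lemma R_positive:
  assumes z: "admissible z" and cz: "continuous_on {0..T} (z (Suc k))" and zT: "z (Suc k) T = 0"
    and cl: "continuous_on {0..T} lam" and lT: "0 < lam T" and H0: "0 < tail_mean f 0"
  shows "0 < R z (Suc k) 0"
proof -
  obtain c where c: "R z k \<in> borel_measurable borel"
    "\<And>t. 0 \<le> R z k t \<and> R z k t \<le> c" using R_bounded_measurable z by metis
  have [measurable]: "z i \<in> borel_measurable borel" and z0: "0 \<le> z i s" for i s
    using z by (auto simp: admissible_def)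
  \<comment> \<open>The minorant drops the reward of the remaining workers and replaces the survival
    probability by its lower bound \<open>exp (- (L * T))\<close>.\<close>
  define w where "w \<tau> = tail_mean f (z (Suc k) \<tau>) * lam \<tau> * exp (- (L * T))" for \<tau>
  have cw: "continuous_on {0..T} w"
    unfolding w_def[abs_def]
    by (intro continuous_intros cl continuous_on_compose2[OF H_cont cz]) (use z0 in auto)
  have w0: "0 \<le> w \<tau>" for \<tau>
    unfolding w_def using H_bound[OF z0] lam_nonneg by simp
  have "w T \<noteq> 0" using zT lT H0 by (simp add: w_def)
  then have "integral {0..T} w \<noteq> 0"
    using integral_eq_0_iff[OF cw T_pos w0] T_pos by auto
  moreover have "0 \<le> integral {0..T} w"
    using w0 by (intro integral_nonneg integrable_continuous_interval cw) auto
  moreover have "integral {0..T} w = (LINT \<tau>:{0..T}|lborel. w \<tau>)"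
    using borel_integrable_atLeastAtMost'[OF cw] by (intro set_borel_integral_eq_integral(2)[symmetric])
  moreover have "(LINT \<tau>:{0..T}|lborel. w \<tau>) \<le> R z (Suc k) 0"
    unfolding R_Suc set_lebesgue_integral_def
  proof (rule integral_mono)
    show "integrable lborel (\<lambda>\<tau>. indicator {0..T} \<tau> *\<^sub>R w \<tau>)"
      using borel_integrable_atLeastAtMost'[OF cw] by (simp add: set_integrable_def)
    show "integrable lborel (integrand z k 0)"
    proof (rule Bochner_Integration.integrable_bound[where f = "\<lambda>\<tau>. (\<mu> + c) * L * indicator {0..T} \<tau>"])
      show "integrand z k 0 \<in> borel_measurable lborel"
        using measurable_Pair2[OF integrand_meas[OF z c(1)], of 0] by simp
      show "AE \<tau> in lborel. norm (integrand z k 0 \<tau>) \<le> norm ((\<mu> + c) * L * indicator {0..T} \<tau>)"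
        using integrand_bounds[OF z c(2)] by (intro AE_I2) (simp add: order_trans[OF _ abs_ge_self])
    qed (use integrable_bound_function[of "(\<mu> + c) * L"] in simp_all)
    fix \<tau>
    have "w \<tau> \<le> (tail_mean f (z (Suc k) \<tau>) + (1 - F (z (Suc k) \<tau>)) * R z k \<tau>)
      * lam \<tau> * exp (- (LINT \<sigma>:{0..\<tau>}|lborel. lam \<sigma> * (1 - F (z (Suc k) \<sigma>))))"
      unfolding w_def
      using H_bound[OF z0] lam_nonneg c(2) F_le inner_integral_bounds(2)[of "z (Suc k)" 0 \<tau>]
      by (intro mult_mono mult_nonneg_nonneg add_nonneg_nonneg) auto
    then show "indicator {0..T} \<tau> *\<^sub>R w \<tau> \<le> integrand z k 0 \<tau>"
      unfolding integrand_def by (cases "\<tau> \<in> {0..T}") auto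
  qed
  ultimately show ?thesis by linarith
qed

end

section \<open>Mean shortage and tail mean of the job value law\<close>

locale job_value_law =
  fixes D :: "real measure" and f :: "real \<Rightarrow> real"
  assumes f_meas [measurable]: "f \<in> borel_measurable borel" and f_nonneg: "0 \<le> f x"
    and D_dist: "real_distribution D" and D_density: "D = density lborel (\<lambda>x. ennreal (f x))"
    and D_nonneg: "AE x in D. 0 \<le> x" and D_mean: "integrable D (\<lambda>x. x)" "0 < (\<integral>x. x \<partial>D)"
begin

sublocale D: real_distribution D by (rule D_dist)

abbreviation "\<mu> \<equiv> \<integral>x. x \<partial>D"

lemma D_integral:
  assumes [measurable]: "g \<in> borel_measurable borel"
  shows "(\<integral>x. g x \<partial>D) = (\<integral>x. g x * f x \<partial>lborel)"
  unfolding D_density using f_nonneg by (subst integral_density) (auto simp: mult.commute)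

lemma measure_singleton: "measure D {x} = 0"
proof -
  have "emeasure D {x} = (\<integral>\<^sup>+ u. ennreal (f u) * indicator {x} u \<partial>lborel)"
    unfolding D_density by (rule emeasure_density) auto
  also have "\<dots> = 0"
    by (subst nn_integral_0_iff_AE) (use AE_lborel_singleton[of x] in auto)
  finally show ?thesis by (simp add: measure_def)
qed

lemma cdf_continuous: "continuous_on UNIV (cdf D)"
  using D.isCont_cdf measure_singleton by (simp add: continuous_at_imp_continuous_on)

lemma cdf_bounds: "0 \<le> cdf D x" "cdf D x \<le> 1"
  by (simp_all add: cdf_def)

lemma shortage_integrable: "integrable D (\<lambda>x. max (x - y) 0)"
proof (rule Bochner_Integration.integrable_bound)
  show "integrable D (\<lambda>x. \<bar>x\<bar> + \<bar>y\<bar>)" using D_mean(1) by simp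
  show "AE x in D. norm (max (x - y) 0) \<le> norm (\<bar>x\<bar> + \<bar>y\<bar>)" by (intro AE_I2) auto
qed simp

lemma mean_shortage_eq: "mean_shortage f y = (\<integral>x. max (x - y) 0 \<partial>D)"
  unfolding mean_shortage_def set_lebesgue_integral_def
  by (subst D_integral) (auto intro!: Bochner_Integration.integral_cong simp: indicator_def max_def)

text \<open>Splits x on {x \<ge> y} into (x - y) + y. Continuity of the tail mean is thereby reduced
  to that of the mean shortage function and of the cdf.\<close>

lemma tail_mean_eq: "tail_mean f y = mean_shortage f y + y * (1 - cdf D y)"
proof -
  have i: "integrable D (\<lambda>x. y * indicator {y..} x)"
    by (intro integrable_mult_right integrable_real_indicator) (auto simp: less_top[symmetric])
  have "tail_mean f y = (\<integral>x. indicator {y..} x * x \<partial>D)"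
    unfolding tail_mean_def set_lebesgue_integral_def
    by (subst D_integral) (auto intro!: Bochner_Integration.integral_cong simp: mult.assoc)
  also have "\<dots> = (\<integral>x. max (x - y) 0 + y * indicator {y..} x \<partial>D)"
    by (intro Bochner_Integration.integral_cong) (auto simp: indicator_def)
  also have "\<dots> = mean_shortage f y + y * measure D {y..}"
    unfolding mean_shortage_eq using shortage_integrable i by (subst Bochner_Integration.integral_add) auto
  \<comment> \<open>The law has no atoms, so the closed and the open half line have the same
    mass.\<close>
  also have "measure D {y..} = 1 - cdf D y"
  proof -
    have "measure D {y<..} = measure D {y..}"
      by (intro D.finite_measure_eq_AE)
        (use measure_singleton[of y] D.prob_eq_0[of "{y}"] in \<open>auto elim!: eventually_mono\<close>)
    moreover have "measure D (space D - {..y}) = 1 - measure D {..y}"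
      by (intro D.prob_compl) auto
    moreover have "space D - {..y} = {y<..}" by auto
    ultimately show ?thesis by (simp add: cdf_def)
  qed
  finally show ?thesis .
qed

lemma mean_shortage_antimono: "a \<le> b \<Longrightarrow> mean_shortage f b \<le> mean_shortage f a"
  unfolding mean_shortage_eq by (intro integral_mono shortage_integrable) auto

lemma mean_shortage_nonneg: "0 \<le> mean_shortage f a"
  unfolding mean_shortage_eq by (intro integral_nonneg_AE) auto

lemma mean_shortage_0: "mean_shortage f 0 = \<mu>"
  unfolding mean_shortage_eq using D_nonneg by (intro integral_cong_AE) auto

lemma mean_shortage_lipschitz: "\<bar>mean_shortage f a - mean_shortage f b\<bar> \<le> \<bar>a - b\<bar>"
proof -
  have "\<bar>mean_shortage f a - mean_shortage f b\<bar> = \<bar>\<integral>x. max (x - a) 0 - max (x - b) 0 \<partial>D\<bar>"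
    unfolding mean_shortage_eq
    by (subst Bochner_Integration.integral_diff[OF shortage_integrable shortage_integrable]) simp
  also have "\<dots> \<le> (\<integral>x. \<bar>max (x - a) 0 - max (x - b) 0\<bar> \<partial>D)"
    by (rule integral_abs_bound)
  also have "\<dots> \<le> (\<integral>x. \<bar>a - b\<bar> \<partial>D)"
    by (intro integral_mono integrable_abs Bochner_Integration.integrable_diff shortage_integrable) auto
  finally show ?thesis by (simp add: D.prob_space[unfolded D.space_eq_univ])
qed

text \<open>For y \<ge> 0 the shortage is dominated by |x|. The limit disposes of large arguments
  when pointwise closeness is made uniform.\<close>

lemma mean_shortage_tendsto_0: "((mean_shortage f) \<longlongrightarrow> 0) at_top"
proof -
  have "((\<lambda>y. \<integral>x. max (x - y) 0 \<partial>D) \<longlongrightarrow> (\<integral>x. 0 \<partial>D)) at_top"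
  proof (rule integral_dominated_convergence_at_top[where w = "\<lambda>x. \<bar>x\<bar>"])
    show "\<forall>\<^sub>F y in at_top. AE x in D. norm (max (x - y) 0) \<le> \<bar>x\<bar>"
      using eventually_ge_at_top[of 0] by eventually_elim (auto intro!: AE_I2)
    show "AE x in D. ((\<lambda>y. max (x - y) 0) \<longlongrightarrow> 0) at_top"
    proof (rule AE_I2)
      fix x :: real
      have "\<forall>\<^sub>F y in at_top. max (x - y) 0 = 0"
        using eventually_ge_at_top[of x] by eventually_elim auto
      then show "((\<lambda>y. max (x - y) 0) \<longlongrightarrow> 0) at_top" by (rule tendsto_eventually)
    qed
    show "integrable D (\<lambda>x. \<bar>x\<bar>)" using D_mean(1) by (rule integrable_abs)
  qed auto
  then show ?thesis by (simp add: mean_shortage_eq[abs_def])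
qed

lemma mean_shortage_continuous: "continuous_on UNIV (mean_shortage f)"
  unfolding continuous_on_iff dist_real_def
proof (intro ballI allI impI exI conjI)
  fix a b e :: real assume "\<bar>b - a\<bar> < e"
  then show "\<bar>mean_shortage f b - mean_shortage f a\<bar> < e"
    using mean_shortage_lipschitz[of b a] by simp
qed

lemma tail_mean_continuous: "continuous_on UNIV (tail_mean f)"
  unfolding tail_mean_eq[abs_def]
  by (intro continuous_intros mean_shortage_continuous cdf_continuous)

lemma tail_mean_0: "tail_mean f 0 = \<mu>"
  by (simp add: tail_mean_eq mean_shortage_0)

lemma tail_mean_bounds:
  assumes "0 \<le> y"
  shows "0 \<le> tail_mean f y" "tail_mean f y \<le> \<mu>"
proof -
  show "0 \<le> tail_mean f y"
    unfolding tail_mean_eq using assms mean_shortage_nonneg[of y] cdf_bounds(2)[of y]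
    by (intro add_nonneg_nonneg mult_nonneg_nonneg) auto
  have "tail_mean f y = (\<integral>x. indicator {y..} x * x \<partial>D)"
    unfolding tail_mean_def set_lebesgue_integral_def
    by (subst D_integral) (auto intro!: Bochner_Integration.integral_cong simp: mult.assoc)
  also have "\<dots> \<le> \<mu>"
    using D_mean(1) D_nonneg by (intro integral_mono_AE') (auto simp: indicator_def elim!: eventually_mono)
  finally show "tail_mean f y \<le> \<mu>" .
qed

end

section \<open>The reward as a continuous function of the curves\<close>

locale npsa_setting = job_value_law D f for D f +
  fixes T :: real and n :: nat and lam :: "real \<Rightarrow> real"
  assumes T_pos: "0 < T" and n_pos: "1 \<le> n"
    and lam_cont: "continuous_on {0..T} lam" and lam_pos: "t \<in> {0..T} \<Longrightarrow> 0 < lam t"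
begin

definition "L = (SUP t\<in>{0..T}. lam t)"

lemma lam_le_L: "t \<in> {0..T} \<Longrightarrow> lam t \<le> L"
  unfolding L_def
  by (intro cSUP_upper bounded_imp_bdd_above compact_imp_bounded compact_continuous_image lam_cont) auto

lemma L_pos: "0 < L"
  using lam_pos[of 0] lam_le_L[of 0] T_pos by simp

text \<open>The hypotheses speak about \<open>lam\<close> on \<open>{0..T}\<close> only; the cut-off
  version is measurable and bounded on the whole line.\<close>

definition "lam0 s = indicator {0..T} s * lam s"

sublocale reward: reward_setting T L \<mu> lam0 "cdf D" f
proof
  have "(\<lambda>s. indicator {0..T} s *\<^sub>R lam s) \<in> borel_measurable borel"
    by (intro borel_measurable_continuous_on_indicator lam_cont) auto
  then show "lam0 \<in> borel_measurable borel" by (simp add: lam0_def[abs_def])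
  show "0 \<le> lam0 t" "lam0 t \<le> L * indicator {0..T} t" for t
    using lam_pos[of t] lam_le_L[of t] by (auto simp: lam0_def indicator_def)
  show "continuous_on {0..} (tail_mean f)"
    using tail_mean_continuous by (rule continuous_on_subset) simp
qed (use T_pos cdf_bounds tail_mean_bounds cdf_continuous in auto)

text \<open>Curves are constrained only for indices in \<open>{1..n}\<close> and times in
  \<open>{0..T}\<close>; setting everything else to 0 makes them globally measurable and nonnegative
  without changing the reward.\<close>

definition trim :: "(nat \<Rightarrow> real \<Rightarrow> real) \<Rightarrow> nat \<Rightarrow> real \<Rightarrow> real" where
  "trim z i s = (if i \<in> {1..n} then indicator {0..T} s * z i s else 0)"

definition curves :: "(nat \<Rightarrow> real \<Rightarrow> real) \<Rightarrow> bool" where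
  "curves z \<longleftrightarrow> (\<forall>i\<in>{1..n}. continuous_on {0..T} (z i) \<and> (\<forall>t\<in>{0..T}. 0 \<le> z i t))"

abbreviation value_of :: "(nat \<Rightarrow> real \<Rightarrow> real) \<Rightarrow> real" where
  "value_of z \<equiv> expected_reward T lam (cdf D) f z n 0"

lemma admissible_trim:
  assumes "curves z" shows "reward.admissible (trim z)"
  unfolding reward.admissible_def
proof (intro allI conjI)
  fix i
  have "(\<lambda>s. indicator {0..T} s *\<^sub>R z i s) \<in> borel_measurable borel" if "i \<in> {1..n}"
    using assms that by (intro borel_measurable_continuous_on_indicator) (auto simp: curves_def)
  then show "trim z i \<in> borel_measurable borel"
    by (cases "i \<in> {1..n}") (auto simp: trim_def[abs_def])
  show "0 \<le> trim z i s" for s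
    using assms by (auto simp: trim_def curves_def indicator_def)
qed

lemma value_of_trim: "value_of z = reward.R (trim z) n 0"
  by (rule expected_reward_cong) (auto simp: lam0_def trim_def)

text \<open>If no \<open>d\<close> worked, curves within 1/(m+1) of \<open>w\<close> with reward off
  by at least \<open>e\<close> would exist for every m, against the sequential continuity in
  \<open>reward.R_tendsto\<close>.\<close>

lemma value_of_continuous:
  assumes w: "curves w" and e: "0 < e"
  shows "\<exists>d>0. \<forall>z. curves z \<and> (\<forall>i\<in>{1..n}. \<forall>t\<in>{0..T}. \<bar>z i t - w i t\<bar> \<le> d) \<longrightarrow>
      \<bar>value_of z - value_of w\<bar> < e"
proof (rule ccontr)
  assume "\<not> ?thesis"
  then have "\<forall>d>0. \<exists>z. curves z \<and> (\<forall>i\<in>{1..n}. \<forall>t\<in>{0..T}. \<bar>z i t - w i t\<bar> \<le> d) \<and>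
      e \<le> \<bar>value_of z - value_of w\<bar>" by (metis not_less)
  then have "\<forall>m. \<exists>z. curves z \<and> (\<forall>i\<in>{1..n}. \<forall>t\<in>{0..T}. \<bar>z i t - w i t\<bar> \<le> inverse (real (Suc m))) \<and>
      e \<le> \<bar>value_of z - value_of w\<bar>" by simp
  then obtain Z where Z: "\<And>m. curves (Z m)" "\<And>m i t. i \<in> {1..n} \<Longrightarrow> t \<in> {0..T} \<Longrightarrow>
      \<bar>Z m i t - w i t\<bar> \<le> inverse (real (Suc m))" "\<And>m. e \<le> \<bar>value_of (Z m) - value_of w\<bar>" by metis
  have "(\<lambda>m. reward.R (trim (Z m)) n 0) \<longlonglongrightarrow> reward.R (trim w) n 0"
  proof (rule reward.R_tendsto)
    show "(\<lambda>m. trim (Z m) i s) \<longlonglongrightarrow> trim w i s" if i: "i \<in> {1..n}" for i s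
    proof (cases "s \<in> {0..T}")
      case True
      have "(\<lambda>m. Z m i s - w i s) \<longlonglongrightarrow> 0"
        using Z(2)[OF i True] by (intro tendsto_0_le[OF LIMSEQ_inverse_real_of_nat, of _ 1]) auto
      then show ?thesis using True i by (simp add: trim_def LIM_zero_iff)
    next
      case False
      then have "trim z i s = 0" for z by (auto simp: trim_def indicator_def)
      then show ?thesis by simp
    qed
  qed (use admissible_trim w Z in auto)
  then have "(\<lambda>m. value_of (Z m)) \<longlonglongrightarrow> value_of w" by (simp add: value_of_trim)
  then have "\<forall>\<^sub>F m in sequentially. \<bar>value_of (Z m) - value_of w\<bar> < e"
    using e by (auto simp: tendsto_iff dist_real_def)
  then show False using Z(3) by (auto simp: eventually_sequentially not_less[symmetric])
qed

text \<open>Positivity makes the quotient in the theorem a genuine one (division by 0 would give 0)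
  and turns an absolute error of the reward into a relative one.\<close>

lemma optimal_value_positive:
  assumes "optimal_critical_curves T lam f n y"
  shows "curves y" "0 < value_of y"
proof -
  have "continuous_on {0..T} (y i)" if "i \<in> {1..n}" for i
    unfolding continuous_on_eq_continuous_within
    using assms that by (auto simp: optimal_critical_curves_def solves_curve_equations_def
        dest!: bspec intro: DERIV_continuous)
  then show y: "curves y"
    using assms by (auto simp: curves_def optimal_critical_curves_def solves_curve_equations_def)
  obtain k where k: "n = Suc k" using n_pos by (cases n) auto
  then have kn: "Suc k \<le> n" by simp
  have "continuous_on {0..T} (y (Suc k))" using y unfolding curves_def by (auto simp: k)
  then have "continuous_on {0..T} (trim y (Suc k))"
    by (rule continuous_on_eq) (auto simp: trim_def kn)
  moreover have "continuous_on {0..T} lam0"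
    using lam_cont by (rule continuous_on_eq) (simp add: lam0_def)
  moreover have "trim y (Suc k) T = 0"
    using assms kn by (auto simp: trim_def optimal_critical_curves_def solves_curve_equations_def)
  moreover have "0 < lam0 T" using lam_pos[of T] T_pos by (simp add: lam0_def)
  ultimately have "0 < reward.R (trim y) (Suc k) 0"
    using D_mean(2) by (intro reward.R_positive admissible_trim y) (auto simp: tail_mean_0)
  then show "0 < value_of y" using value_of_trim[of y] k by simp
qed

end

subsection \<open>Weak laws of large numbers\<close>

context prob_space
begin

text \<open>The events \<open>G m\<close> are there because \<open>Q m\<close> need not be measurable.\<close>

definition whp :: "(nat \<Rightarrow> 'a \<Rightarrow> bool) \<Rightarrow> bool" where
  "whp Q \<longleftrightarrow> (\<exists>G. (\<forall>m. G m \<in> events \<and> (\<forall>\<omega>\<in>G m. Q m \<omega>)) \<and> (\<lambda>m. prob (G m)) \<longlonglongrightarrow> 1)"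

lemma whpI:
  assumes B: "\<And>m. B m \<in> events" and lim: "(\<lambda>m. prob (B m)) \<longlonglongrightarrow> 0"
    and Q: "\<And>m \<omega>. m \<ge> m0 \<Longrightarrow> \<omega> \<in> space M \<Longrightarrow> \<omega> \<notin> B m \<Longrightarrow> Q m \<omega>"
  shows "whp Q"
  unfolding whp_def
proof (intro exI[of _ "\<lambda>m. if m \<ge> m0 then space M - B m else {}"] conjI allI)
  have "(\<lambda>m. 1 - prob (B m)) \<longlonglongrightarrow> 1 - 0" by (intro tendsto_intros lim)
  then have "(\<lambda>m. prob (space M - B m)) \<longlonglongrightarrow> 1" using prob_compl[OF B] by simp
  then show "(\<lambda>m. prob (if m \<ge> m0 then space M - B m else {})) \<longlonglongrightarrow> 1"
    by (rule Lim_transform_eventually) (auto intro: eventually_mono[OF eventually_ge_at_top[of m0]])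
qed (use B Q in auto)

lemma whp_mono:
  assumes "whp Q" and "\<And>m \<omega>. m \<ge> m0 \<Longrightarrow> \<omega> \<in> space M \<Longrightarrow> Q m \<omega> \<Longrightarrow> Q' m \<omega>"
  shows "whp Q'"
proof -
  obtain G where G: "\<And>m. G m \<in> events" "\<And>m \<omega>. \<omega> \<in> G m \<Longrightarrow> Q m \<omega>" "(\<lambda>m. prob (G m)) \<longlonglongrightarrow> 1"
    using assms(1) unfolding whp_def by metis
  show ?thesis
  proof (rule whpI[where B = "\<lambda>m. space M - G m" and ?m0.0 = m0])
    have "(\<lambda>m. 1 - prob (G m)) \<longlonglongrightarrow> 1 - 1" by (intro tendsto_intros G)
    then show "(\<lambda>m. prob (space M - G m)) \<longlonglongrightarrow> 0" using prob_compl[OF G(1)] by simp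
  qed (use G assms(2) in auto)
qed

lemma whp_conj:
  assumes "whp Q" "whp Q'"
  shows "whp (\<lambda>m \<omega>. Q m \<omega> \<and> Q' m \<omega>)"
proof -
  obtain G where G: "\<And>m. G m \<in> events" "\<And>m \<omega>. \<omega> \<in> G m \<Longrightarrow> Q m \<omega>" "(\<lambda>m. prob (G m)) \<longlonglongrightarrow> 1"
    using assms(1) unfolding whp_def by metis
  obtain G' where G': "\<And>m. G' m \<in> events" "\<And>m \<omega>. \<omega> \<in> G' m \<Longrightarrow> Q' m \<omega>" "(\<lambda>m. prob (G' m)) \<longlonglongrightarrow> 1"
    using assms(2) unfolding whp_def by metis
  have "(\<lambda>m. prob (G m) + prob (G' m) - 1) \<longlonglongrightarrow> 1 + 1 - 1" by (intro tendsto_intros G G')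
  then have low: "(\<lambda>m. prob (G m) + prob (G' m) - 1) \<longlonglongrightarrow> 1" by simp
  have le: "prob (G m) + prob (G' m) - 1 \<le> prob (G m \<inter> G' m)" for m
  proof -
    have "prob (G m \<union> G' m) = prob (G m) + prob (G' m) - prob (G m \<inter> G' m)"
      using G(1) G'(1) by (intro measure_Un3) (auto simp: fmeasurable_eq_sets)
    then show ?thesis using prob_le_1[of "G m \<union> G' m"] by linarith
  qed
  have "(\<lambda>m. prob (G m \<inter> G' m)) \<longlonglongrightarrow> 1"
    by (rule tendsto_sandwich[OF _ _ low tendsto_const]) (use le in auto)
  then show ?thesis
    unfolding whp_def using G G' by (intro exI[of _ "\<lambda>m. G m \<inter> G' m"]) auto
qed

lemma whp_ball:
  assumes "finite I" "\<And>i. i \<in> I \<Longrightarrow> whp (Q i)"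
  shows "whp (\<lambda>m \<omega>. \<forall>i\<in>I. Q i m \<omega>)"
  using assms
proof (induction I)
  case empty
  show ?case by (rule whpI[where B = "\<lambda>_. {}" and ?m0.0 = 0]) auto
next
  case (insert i I)
  then show ?case using whp_conj[of "Q i" "\<lambda>m \<omega>. \<forall>i\<in>I. Q i m \<omega>"] by simp
qed

text \<open>The way back from inner events to the probability of \<open>Q\<close> itself, which
  requires \<open>Q\<close> to be an event. The bound \<open>m0\<close> leaves room for the case of
  no realisation, where the curves are unspecified.\<close>

lemma whp_event:
  assumes "whp Q" and E: "\<And>m. m \<ge> m0 \<Longrightarrow> {\<omega> \<in> space M. Q m \<omega>} \<in> events"
  shows "(\<lambda>m. prob {\<omega> \<in> space M. Q m \<omega>}) \<longlonglongrightarrow> 1"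
proof -
  obtain G where G: "\<And>m. G m \<in> events" "\<And>m \<omega>. \<omega> \<in> G m \<Longrightarrow> Q m \<omega>" "(\<lambda>m. prob (G m)) \<longlonglongrightarrow> 1"
    using assms(1) unfolding whp_def by metis
  show ?thesis
  proof (rule tendsto_sandwich[OF _ _ G(3) tendsto_const])
    show "\<forall>\<^sub>F m in sequentially. prob (G m) \<le> prob {\<omega> \<in> space M. Q m \<omega>}"
      using eventually_ge_at_top[of m0]
    proof eventually_elim
      case (elim m)
      show ?case using G(1,2) sets.sets_into_space by (intro finite_measure_mono E elim) blast
    qed
  qed simp
qed

text \<open>Expand the square into a double sum; by pairwise independence and centring the mixed
  terms have mean 0.\<close>

lemma second_moment_sum_indep:
  fixes Z :: "'i \<Rightarrow> 'a \<Rightarrow> real"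
  assumes ind: "indep_vars (\<lambda>_. borel) Z I" and I: "finite I"
    and sq: "\<And>i. i \<in> I \<Longrightarrow> integrable M (\<lambda>\<omega>. (Z i \<omega>)\<^sup>2)" and mean: "\<And>i. i \<in> I \<Longrightarrow> expectation (Z i) = 0"
  shows "integrable M (\<lambda>\<omega>. (\<Sum>i\<in>I. Z i \<omega>)\<^sup>2)"
    and "expectation (\<lambda>\<omega>. (\<Sum>i\<in>I. Z i \<omega>)\<^sup>2) = (\<Sum>i\<in>I. expectation (\<lambda>\<omega>. (Z i \<omega>)\<^sup>2))"
proof -
  have rv: "random_variable borel (Z i)" if "i \<in> I" for i using ind that by (simp add: indep_vars_def)
  have int: "integrable M (Z i)" if "i \<in> I" for i
    using square_integrable_imp_integrable[OF rv sq] that by blast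
  have prod: "integrable M (\<lambda>\<omega>. Z i \<omega> * Z j \<omega>) \<and>
      expectation (\<lambda>\<omega>. Z i \<omega> * Z j \<omega>) = (if i = j then expectation (\<lambda>\<omega>. (Z i \<omega>)\<^sup>2) else 0)"
    if ij: "i \<in> I" "j \<in> I" for i j
  proof (cases "i = j")
    case True
    then show ?thesis using sq ij by (simp add: power2_eq_square)
  next
    case False
    have "indep_vars (\<lambda>_. borel) Z {i, j}" using indep_vars_subset[OF ind] ij by auto
    then have "integrable M (\<lambda>\<omega>. \<Prod>l\<in>{i, j}. Z l \<omega>)"
      "expectation (\<lambda>\<omega>. \<Prod>l\<in>{i, j}. Z l \<omega>) = (\<Prod>l\<in>{i, j}. expectation (Z l))"
      using int ij by (auto intro!: indep_vars_integrable indep_vars_lebesgue_integral)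
    then show ?thesis using False mean ij by simp
  qed
  have eq: "(\<Sum>i\<in>I. Z i \<omega>)\<^sup>2 = (\<Sum>i\<in>I. \<Sum>j\<in>I. Z i \<omega> * Z j \<omega>)" for \<omega>
    by (simp add: power2_eq_square sum_product)
  show "integrable M (\<lambda>\<omega>. (\<Sum>i\<in>I. Z i \<omega>)\<^sup>2)"
    unfolding eq using prod by (intro Bochner_Integration.integrable_sum) auto
  have "expectation (\<lambda>\<omega>. (\<Sum>i\<in>I. Z i \<omega>)\<^sup>2) = (\<Sum>i\<in>I. \<Sum>j\<in>I. expectation (\<lambda>\<omega>. Z i \<omega> * Z j \<omega>))"
    unfolding eq using prod by (simp add: Bochner_Integration.integral_sum)
  also have "\<dots> = (\<Sum>i\<in>I. \<Sum>j\<in>I. if i = j then expectation (\<lambda>\<omega>. (Z i \<omega>)\<^sup>2) else 0)"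
    using prod by (intro sum.cong refl) auto
  also have "\<dots> = (\<Sum>i\<in>I. expectation (\<lambda>\<omega>. (Z i \<omega>)\<^sup>2))"
    using I by (simp add: sum.delta)
  finally show "expectation (\<lambda>\<omega>. (\<Sum>i\<in>I. Z i \<omega>)\<^sup>2) = (\<Sum>i\<in>I. expectation (\<lambda>\<omega>. (Z i \<omega>)\<^sup>2))" .
qed

lemma chebyshev_average:
  fixes Y :: "nat \<Rightarrow> 'a \<Rightarrow> real"
  assumes ind: "indep_vars (\<lambda>_. borel) Y UNIV" and sq: "\<And>i. integrable M (\<lambda>\<omega>. (Y i \<omega>)\<^sup>2)"
    and mean: "\<And>i. expectation (Y i) = \<nu>" and V: "\<And>i. variance (Y i) \<le> V"
    and \<eta>: "0 < \<eta>" and m: "0 < m"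
  shows "prob {\<omega> \<in> space M. \<eta> \<le> \<bar>(\<Sum>i<m. Y i \<omega>) / real m - \<nu>\<bar>} \<le> V / (real m * \<eta>\<^sup>2)"
proof -
  have rv [measurable]: "random_variable borel (Y i)" for i using ind by (simp add: indep_vars_def)
  have int: "integrable M (Y i)" for i using square_integrable_imp_integrable[OF rv sq] .
  define Z where "Z i \<omega> = Y i \<omega> - \<nu>" for i \<omega>
  have "indep_vars (\<lambda>_. borel) (\<lambda>i \<omega>. Y i \<omega> - \<nu>) UNIV"
    using ind by (rule indep_vars_compose2[where Y = "\<lambda>_ x. x - \<nu>"]) simp
  then have indZ: "indep_vars (\<lambda>_. borel) Z {..<m}"
    unfolding Z_def[abs_def] by (rule indep_vars_subset) simp
  have sqZ: "integrable M (\<lambda>\<omega>. (Z i \<omega>)\<^sup>2)" for i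
    unfolding Z_def power2_diff using sq int by simp
  have mZ: "expectation (Z i) = 0" for i
    unfolding Z_def using int mean by (simp add: prob_space)
  note sm = second_moment_sum_indep[OF indZ finite_lessThan sqZ mZ]
  have [measurable]: "random_variable borel (Z i)" for i unfolding Z_def by measurable
  have eq: "\<bar>(\<Sum>i<m. Y i \<omega>) / real m - \<nu>\<bar> = \<bar>\<Sum>i<m. Z i \<omega>\<bar> / real m" for \<omega>
  proof -
    have "(\<Sum>i<m. Y i \<omega>) / real m - \<nu> = (\<Sum>i<m. Z i \<omega>) / real m"
      unfolding Z_def using m by (simp add: sum_subtractf field_simps)
    then show ?thesis by simp
  qed
  have "prob {\<omega> \<in> space M. \<eta> \<le> \<bar>(\<Sum>i<m. Y i \<omega>) / real m - \<nu>\<bar>}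
      = prob {\<omega> \<in> space M. \<bar>\<Sum>i<m. Z i \<omega>\<bar> \<ge> real m * \<eta>}"
    unfolding eq using m by (simp add: pos_le_divide_eq mult.commute)
  also have "\<dots> \<le> expectation (\<lambda>\<omega>. (\<Sum>i<m. Z i \<omega>)\<^sup>2) / (real m * \<eta>)\<^sup>2"
    using sm(1) m \<eta> by (intro second_moment_method) auto
  also have "\<dots> = (\<Sum>i<m. variance (Y i)) / (real m * \<eta>)\<^sup>2"
    unfolding sm(2) mean by (simp add: Z_def)
  also have "\<dots> \<le> (real m * V) / (real m * \<eta>)\<^sup>2"
    using sum_bounded_above[of "{..<m}" "\<lambda>i. variance (Y i)" V] V by (intro divide_right_mono) auto
  also have "\<dots> = V / (real m * \<eta>\<^sup>2)" using m by (simp add: power2_eq_square field_simps)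
  finally show ?thesis .
qed

section \<open>Poisson moments and Wald's identity\<close>

text \<open>The integral is computed in \<open>ennreal\<close> over the countable partition by the
  values of \<open>N\<close>, so convergence of the series yields integrability as well.\<close>

lemma expectation_nat_valued:
  assumes N [measurable]: "N \<in> measurable M (count_space UNIV)"
    and g: "\<And>m. 0 \<le> g m" and s: "(\<lambda>m. g m * prob {\<omega> \<in> space M. N \<omega> = m}) sums s"
  shows "integrable M (\<lambda>\<omega>. g (N \<omega>))" "expectation (\<lambda>\<omega>. g (N \<omega>)) = s"
proof -
  have s0: "0 \<le> s" using g by (intro sums_le[OF _ sums_zero s]) simp
  have "(\<integral>\<^sup>+ \<omega>. ennreal (g (N \<omega>)) \<partial>M)
      = (\<integral>\<^sup>+ \<omega>. (\<Sum>m. ennreal (g m) * indicator {\<omega> \<in> space M. N \<omega> = m} \<omega>) \<partial>M)"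
  proof (rule nn_integral_cong)
    fix \<omega> assume "\<omega> \<in> space M"
    then have "(\<lambda>m. ennreal (g m) * indicator {\<omega> \<in> space M. N \<omega> = m} \<omega>)
        = (\<lambda>m. if m = N \<omega> then ennreal (g (N \<omega>)) else 0)" by (auto simp: indicator_def)
    then show "ennreal (g (N \<omega>)) = (\<Sum>m. ennreal (g m) * indicator {\<omega> \<in> space M. N \<omega> = m} \<omega>)"
      using sums_unique[OF sums_single[of "N \<omega>" "\<lambda>m. ennreal (g (N \<omega>))"]] by simp
  qed
  also have "\<dots> = (\<Sum>m. ennreal (g m) * emeasure M {\<omega> \<in> space M. N \<omega> = m})"
    by (subst nn_integral_suminf) (auto simp: nn_integral_cmult_indicator)
  also have "\<dots> = (\<Sum>m. ennreal (g m * prob {\<omega> \<in> space M. N \<omega> = m}))"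
    using g by (simp add: emeasure_eq_measure ennreal_mult)
  also have "\<dots> = ennreal s"
    using g s by (intro suminf_ennreal_eq) auto
  finally have "(\<integral>\<^sup>+ \<omega>. ennreal (g (N \<omega>)) \<partial>M) = ennreal s" .
  moreover have "(\<lambda>\<omega>. g (N \<omega>)) \<in> borel_measurable M" by measurable
  ultimately have "integrable M (\<lambda>\<omega>. g (N \<omega>)) \<and> expectation (\<lambda>\<omega>. g (N \<omega>)) = s"
    using nn_integral_eq_integrable[of "\<lambda>\<omega>. g (N \<omega>)" M s] g s0 by simp
  then show "integrable M (\<lambda>\<omega>. g (N \<omega>))" "expectation (\<lambda>\<omega>. g (N \<omega>)) = s" by auto
qed

text \<open>The law is used as a power series, so that the rate \<open>r\<close> may be 0: a bin may
  be a null set, such as the single point \<open>T\<close>. The identity m r^m / m! = r * r^(m-1) /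
  (m-1)! reduces both moment series to the exponential series.\<close>

lemma poisson_moments:
  assumes N: "N \<in> measurable M (count_space UNIV)"
    and P: "\<And>m. prob {\<omega> \<in> space M. N \<omega> = m} = r ^ m / fact m * exp (- r)"
  shows "integrable M (\<lambda>\<omega>. real (N \<omega>))" "expectation (\<lambda>\<omega>. real (N \<omega>)) = r"
    "integrable M (\<lambda>\<omega>. (real (N \<omega>))\<^sup>2)" "expectation (\<lambda>\<omega>. (real (N \<omega>))\<^sup>2) = r + r\<^sup>2"
proof -
  have s0: "(\<lambda>m. r ^ m / fact m) sums exp r"
    using exp_converges[of r] by (simp add: field_simps)
  have shift: "real (Suc m) * (r ^ Suc m / fact (Suc m)) = r * (r ^ m / fact m)" for m
    by (simp add: divide_simps)
  have "(\<lambda>m. real (Suc m) * (r ^ Suc m / fact (Suc m))) sums (r * exp r)"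
    unfolding shift by (intro sums_mult s0)
  then have s1: "(\<lambda>m. real m * (r ^ m / fact m)) sums (r * exp r)"
    by (subst (asm) sums_Suc_iff) simp
  have "(\<lambda>m. r * (real m * (r ^ m / fact m) + r ^ m / fact m)) sums (r * (r * exp r + exp r))"
    by (intro sums_mult sums_add s0 s1)
  moreover have "r * (real m * (r ^ m / fact m) + r ^ m / fact m)
      = (real (Suc m))\<^sup>2 * (r ^ Suc m / fact (Suc m))" for m
    unfolding power2_eq_square mult.assoc shift by (simp add: algebra_simps add_divide_distrib)
  ultimately have "(\<lambda>m. (real (Suc m))\<^sup>2 * (r ^ Suc m / fact (Suc m))) sums (r * (r * exp r + exp r))"
    by simp
  then have s2: "(\<lambda>m. (real m)\<^sup>2 * (r ^ m / fact m)) sums (r * (r * exp r + exp r))"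
    by (subst (asm) sums_Suc_iff) simp
  have "(\<lambda>m. real m * prob {\<omega> \<in> space M. N \<omega> = m}) sums r"
    using sums_mult2[OF s1, of "exp (- r)"] unfolding P by (simp add: exp_minus mult.assoc)
  from expectation_nat_valued[OF N _ this]
  show "integrable M (\<lambda>\<omega>. real (N \<omega>))" "expectation (\<lambda>\<omega>. real (N \<omega>)) = r" by auto
  have "r * (r * exp r + exp r) * exp (- r) = r + r\<^sup>2"
    by (simp add: exp_minus field_simps power2_eq_square)
  then have "(\<lambda>m. (real m)\<^sup>2 * prob {\<omega> \<in> space M. N \<omega> = m}) sums (r + r\<^sup>2)"
    using sums_mult2[OF s2, of "exp (- r)"] unfolding P by (simp add: mult.assoc)
  from expectation_nat_valued[OF N _ this]
  show "integrable M (\<lambda>\<omega>. (real (N \<omega>))\<^sup>2)" "expectation (\<lambda>\<omega>. (real (N \<omega>))\<^sup>2) = r + r\<^sup>2" by auto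
qed

text \<open>Write the random sum as the series over all j of 1[j < N] Z_j. Each term factorises by
  independence, and the probabilities of j < N add up to the mean of N. Independence of each
  \<open>Z j\<close> from the one event j < N suffices.\<close>

lemma wald:
  fixes Z :: "nat \<Rightarrow> 'a \<Rightarrow> real"
  assumes N [measurable]: "N \<in> measurable M (count_space UNIV)" and EN: "integrable M (\<lambda>\<omega>. real (N \<omega>))"
    and Z: "\<And>j. integrable M (Z j)" "\<And>j. expectation (Z j) = a" "\<And>j. expectation (\<lambda>\<omega>. \<bar>Z j \<omega>\<bar>) = b"
    and ind: "\<And>j. indep_var borel (\<lambda>\<omega>. of_bool (j < N \<omega>) :: real) borel (Z j)"
  shows "integrable M (\<lambda>\<omega>. \<Sum>j<N \<omega>. Z j \<omega>)"
    and "expectation (\<lambda>\<omega>. \<Sum>j<N \<omega>. Z j \<omega>) = expectation (\<lambda>\<omega>. real (N \<omega>)) * a"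
proof -
  let ?I = "\<lambda>j \<omega>. of_bool (j < N \<omega>) :: real"
  have suminf_N: "(\<Sum>j. ?I j \<omega> * h j) = (\<Sum>j<N \<omega>. h j)" for \<omega> and h :: "nat \<Rightarrow> real"
    by (subst suminf_finite[of "{..<N \<omega>}"]) auto
  have sm: "summable (\<lambda>j. norm (?I j \<omega> * h j))" for \<omega> and h :: "nat \<Rightarrow> real"
    by (rule summable_finite[of "{..<N \<omega>}"]) auto
  have intI: "integrable M (?I j)" for j
    by (rule integrable_const_bound[where B = 1]) auto
  \<comment> \<open>The first m indicators add up to min m N, so the partial sums are bounded by the
    mean of \<open>N\<close>.\<close>
  have "summable (\<lambda>j. expectation (?I j))"
  proof (rule summableI_nonneg_bounded)
    fix m
    have "(\<Sum>j<m. expectation (?I j)) = expectation (\<lambda>\<omega>. \<Sum>j<m. ?I j \<omega>)"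
      using intI by (subst Bochner_Integration.integral_sum) auto
    also have "\<dots> \<le> expectation (\<lambda>\<omega>. real (N \<omega>))"
    proof (rule integral_mono[OF Bochner_Integration.integrable_sum EN])
      show "(\<Sum>j<m. ?I j \<omega>) \<le> real (N \<omega>)" for \<omega>
      proof -
        have "(\<Sum>j<m. ?I j \<omega>) = real (card ({..<m} \<inter> {..<N \<omega>}))"
          by (simp add: of_bool_def sum.If_cases Int_def lessThan_def)
        also have "card ({..<m} \<inter> {..<N \<omega>}) \<le> card {..<N \<omega>}" by (intro card_mono) auto
        finally show ?thesis by simp
      qed
    qed (rule intI)
    finally show "(\<Sum>j<m. expectation (?I j)) \<le> expectation (\<lambda>\<omega>. real (N \<omega>))" .
  qed (auto intro!: integral_nonneg_AE)
  then have sumI: "(\<lambda>j. expectation (?I j)) sums expectation (\<lambda>\<omega>. real (N \<omega>))"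
    using sums_integral[of M ?I, OF intI] sm[of _ "\<lambda>_. 1"] suminf_N[of _ "\<lambda>_. 1"] by simp
  have indm: "indep_var borel (?I j) borel (\<lambda>\<omega>. \<bar>Z j \<omega>\<bar>)" for j
    using indep_var_compose[OF ind, of "\<lambda>x. x" borel "abs" borel j] by (simp add: comp_def)
  have prod: "integrable M (\<lambda>\<omega>. ?I j \<omega> * Z j \<omega>)"
      "expectation (\<lambda>\<omega>. ?I j \<omega> * Z j \<omega>) = expectation (?I j) * a"
      "expectation (\<lambda>\<omega>. norm (?I j \<omega> * Z j \<omega>)) = expectation (?I j) * b" for j
    using indep_var_integrable[OF ind intI Z(1), of j] indep_var_lebesgue_integral[OF ind intI Z(1), of j]
      indep_var_lebesgue_integral[OF indm intI integrable_abs[OF Z(1)], of j] Z(2,3)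
    by (simp_all add: abs_mult)
  have sn: "summable (\<lambda>j. expectation (\<lambda>\<omega>. norm (?I j \<omega> * Z j \<omega>)))"
    unfolding prod using sumI by (intro summable_mult2) (rule sums_summable)
  show "integrable M (\<lambda>\<omega>. \<Sum>j<N \<omega>. Z j \<omega>)"
    using integrable_suminf[OF prod(1) _ sn] sm by (simp add: suminf_N)
  have "(\<lambda>j. expectation (?I j) * a) sums expectation (\<lambda>\<omega>. \<Sum>j<N \<omega>. Z j \<omega>)"
    using sums_integral[OF prod(1) _ sn] sm by (simp add: suminf_N prod(2))
  moreover have "(\<lambda>j. expectation (?I j) * a) sums (expectation (\<lambda>\<omega>. real (N \<omega>)) * a)"
    by (rule sums_mult2[OF sumI])
  ultimately show "expectation (\<lambda>\<omega>. \<Sum>j<N \<omega>. Z j \<omega>) = expectation (\<lambda>\<omega>. real (N \<omega>)) * a"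
    by (rule sums_unique2)
qed

end

text \<open>Passes independence of two large sigma-algebras on to functions that are measurable with
  respect to them.\<close>

lemma sigma_sets_vimage_subset:
  assumes "Y \<in> measurable V N"
  shows "sigma_sets (space V) {Y -` B \<inter> space V |B. B \<in> sets N} \<subseteq> sets V"
  by (rule sets.sigma_sets_subset) (use assms in \<open>auto intro: measurable_sets\<close>)

section \<open>Probabilistic structure of the realisations\<close>

locale npsa_sample = npsa_setting D f T n lam + prob_space P
  for D f T n lam and P :: "'w measure" +
  fixes K :: "nat \<Rightarrow> 'w \<Rightarrow> nat" and X A :: "nat \<Rightarrow> nat \<Rightarrow> 'w \<Rightarrow> real"
  assumes realisations: "independent_realisations P T lam D K X A"
begin

lemma arrival_process: "job_arrival_process P T lam D (K i) (X i) (A i)"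
  using realisations by (simp add: independent_realisations_def)

lemma arrival_times: "\<omega> \<in> space P \<Longrightarrow> j < K i \<omega> \<Longrightarrow> A i j \<omega> \<in> {0..T}"
  using arrival_process[of i] by (auto simp: job_arrival_process_def poisson_arrivals_def)

lemma realisation_measurable [measurable]:
  "(\<lambda>\<omega>. (K i \<omega>, \<lambda>j. (X i j \<omega>, A i j \<omega>))) \<in> measurable P
    (count_space UNIV \<Otimes>\<^sub>M (\<Pi>\<^sub>M j\<in>UNIV. borel \<Otimes>\<^sub>M borel))"
  using realisations by (simp add: independent_realisations_def indep_vars_def)

lemma count_measurable [measurable]: "K i \<in> measurable P (count_space UNIV)"
  using measurable_compose[OF realisation_measurable[of i] measurable_fst] by simp

lemma job_measurable: "(\<lambda>\<omega>. (X i j \<omega>, A i j \<omega>)) \<in> measurable P (borel \<Otimes>\<^sub>M borel)"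
proof -
  have "(\<lambda>\<omega>. \<lambda>j. (X i j \<omega>, A i j \<omega>)) \<in> measurable P (\<Pi>\<^sub>M j\<in>UNIV. borel \<Otimes>\<^sub>M borel)"
    using measurable_compose[OF realisation_measurable[of i] measurable_snd] by simp
  then show ?thesis by (rule measurable_compose) (rule measurable_component_singleton, simp)
qed

lemma value_measurable [measurable]: "X i j \<in> borel_measurable P"
  using measurable_compose[OF job_measurable measurable_fst] by simp

lemma arrival_time_measurable [measurable]: "A i j \<in> borel_measurable P"
  using measurable_compose[OF job_measurable measurable_snd] by simp

lemma independent_functionals:
  assumes "g \<in> measurable (count_space UNIV \<Otimes>\<^sub>M (\<Pi>\<^sub>M j\<in>UNIV. borel \<Otimes>\<^sub>M borel)) borel"
  shows "indep_vars (\<lambda>_. borel) (\<lambda>i \<omega>. g (K i \<omega>, \<lambda>j. (X i j \<omega>, A i j \<omega>)) :: real) UNIV"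
  using realisations assms unfolding independent_realisations_def
  by (auto intro: indep_vars_compose2[where M' = "\<lambda>_. count_space UNIV \<Otimes>\<^sub>M (\<Pi>\<^sub>M j\<in>UNIV. borel \<Otimes>\<^sub>M borel)"
      and Y = "\<lambda>_. g"])

text \<open>The independent units are whole realisations, not single jobs. The random upper limit of
  the sum is handled by splitting over its countably many values. With \<open>h\<close> ignoring the
  time this serves the pooled values, with \<open>h\<close> ignoring the value the bin
  counts.\<close>

lemma independent_compound_sums:
  assumes [measurable]: "case_prod h \<in> borel_measurable (borel \<Otimes>\<^sub>M borel)"
  shows "indep_vars (\<lambda>_. borel) (\<lambda>i \<omega>. \<Sum>j<K i \<omega>. h (X i j \<omega>) (A i j \<omega>) :: real) UNIV"
proof -
  let ?N = "count_space UNIV \<Otimes>\<^sub>M (\<Pi>\<^sub>M j\<in>UNIV. borel \<Otimes>\<^sub>M borel) :: (nat \<times> (nat \<Rightarrow> real \<times> real)) measure"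
  have [measurable]: "(\<lambda>p. snd p j) \<in> measurable ?N (borel \<Otimes>\<^sub>M borel)" for j
    by (rule measurable_compose[OF measurable_snd]) (rule measurable_component_singleton, simp)
  have "(\<lambda>p. \<Sum>j<fst p. case_prod h (snd p j)) \<in> borel_measurable ?N"
    by (rule measurable_compose_countable[where f = "\<lambda>m p. \<Sum>j<m. case_prod h (snd p j)"]) measurable
  from independent_functionals[OF this] show ?thesis by simp
qed

lemma value_law: "distr P borel (X i j) = D"
  using arrival_process[of i] by (simp add: job_arrival_process_def)

text \<open>Independence is assumed between the sigma-algebra of count and arrival times and that of
  the values; both variables here are measurable with respect to one of them. This is the form that
  \<open>wald\<close> asks for.\<close>

lemma count_independent_of_value:
  assumes h [measurable]: "h \<in> borel_measurable borel"
  shows "indep_var borel (\<lambda>\<omega>. of_bool (j < K i \<omega>) :: real) borel (\<lambda>\<omega>. h (X i j \<omega>) :: real)"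
  unfolding indep_var_eq
proof (intro conjI)
  let ?V = "vimage_algebra (space P) (\<lambda>\<omega>. (K i \<omega>, \<lambda>j. A i j \<omega>)) (count_space UNIV \<Otimes>\<^sub>M (\<Pi>\<^sub>M j\<in>UNIV. borel))"
  let ?W = "vimage_algebra (space P) (\<lambda>\<omega> j. X i j \<omega>) (\<Pi>\<^sub>M j\<in>UNIV. borel)"
  have ind: "indep_set (sets ?V) (sets ?W)"
    using arrival_process[of i] by (simp add: job_arrival_process_def)
  have 1: "sigma_sets (space P) {(\<lambda>\<omega>. of_bool (j < K i \<omega>) :: real) -` B \<inter> space P |B. B \<in> sets borel} \<subseteq> sets ?V"
  proof -
    have "(\<lambda>\<omega>. (K i \<omega>, \<lambda>j. A i j \<omega>)) \<in> measurable ?V (count_space UNIV \<Otimes>\<^sub>M (\<Pi>\<^sub>M j\<in>UNIV. borel))"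
      by (rule measurable_vimage_algebra1) (auto simp: space_pair_measure space_PiM)
    from measurable_compose[OF this measurable_fst]
    have [measurable]: "K i \<in> measurable ?V (count_space UNIV)" by simp
    have "(\<lambda>\<omega>. of_bool (j < K i \<omega>) :: real) \<in> borel_measurable ?V" by measurable
    from sigma_sets_vimage_subset[OF this] show ?thesis by simp
  qed
  have 2: "sigma_sets (space P) {(\<lambda>\<omega>. h (X i j \<omega>)) -` B \<inter> space P |B. B \<in> sets borel} \<subseteq> sets ?W"
  proof -
    have "(\<lambda>\<omega> j. X i j \<omega>) \<in> measurable ?W (\<Pi>\<^sub>M j\<in>UNIV. borel)"
      by (rule measurable_vimage_algebra1) (auto simp: space_PiM)
    from measurable_compose[OF this measurable_component_singleton[of j]]
    have [measurable]: "X i j \<in> borel_measurable ?W" by simp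
    have "(\<lambda>\<omega>. h (X i j \<omega>)) \<in> borel_measurable ?W" by measurable
    from sigma_sets_vimage_subset[OF this] show ?thesis by simp
  qed
  show "indep_set (sigma_sets (space P) {(\<lambda>\<omega>. of_bool (j < K i \<omega>) :: real) -` B \<inter> space P |B. B \<in> sets borel})
      (sigma_sets (space P) {(\<lambda>\<omega>. h (X i j \<omega>)) -` B \<inter> space P |B. B \<in> sets borel})"
    using ind unfolding indep_set_def
    by (rule indep_sets_mono_sets) (use 1 2 in \<open>auto split: bool.split\<close>)
qed measurable

text \<open>The expected number of jobs in one realisation.\<close>

definition "\<Lambda> = (LINT t:{0..T}|lborel. lam t)"

lemma arrivals_measurable [measurable]:
  assumes [measurable]: "B \<in> sets borel"
  shows "arrivals_in B (K i) (A i) \<in> measurable P (count_space UNIV)"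
proof -
  have "arrivals_in B (K i) (A i) = (\<lambda>\<omega>. \<Sum>j<K i \<omega>. of_bool (A i j \<omega> \<in> B))"
    by (auto simp: arrivals_in_def fun_eq_iff of_bool_def sum.If_cases Int_def intro!: arg_cong[where f = card])
  moreover have "(\<lambda>\<omega>. \<Sum>j<K i \<omega>. of_bool (A i j \<omega> \<in> B) :: nat) \<in> measurable P (count_space UNIV)"
    by (rule measurable_compose_countable[where f = "\<lambda>m \<omega>. \<Sum>j<m. of_bool (A i j \<omega> \<in> B)"]) measurable
  ultimately show ?thesis by simp
qed

lemma arrivals_law:
  assumes "B \<in> sets borel" "B \<subseteq> {0..T}"
  shows "prob {\<omega> \<in> space P. arrivals_in B (K i) (A i) \<omega> = m}
    = (LINT t:B|lborel. lam t) ^ m / fact m * exp (- (LINT t:B|lborel. lam t))"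
  using arrival_process[of i] assms by (auto simp: job_arrival_process_def poisson_arrivals_def)

lemma count_eq_arrivals: "\<omega> \<in> space P \<Longrightarrow> arrivals_in {0..T} (K i) (A i) \<omega> = K i \<omega>"
  using arrival_times[of \<omega>] by (auto simp: arrivals_in_def intro!: arg_cong[where f = card, of _ "{..<K i \<omega>}", simplified])

lemma count_law: "prob {\<omega> \<in> space P. K i \<omega> = m} = \<Lambda> ^ m / fact m * exp (- \<Lambda>)"
proof -
  have "{\<omega> \<in> space P. K i \<omega> = m} = {\<omega> \<in> space P. arrivals_in {0..T} (K i) (A i) \<omega> = m}"
    using count_eq_arrivals by auto
  then show ?thesis using arrivals_law[of "{0..T}"] by (simp add: \<Lambda>_def)
qed

lemmas count_moments = poisson_moments[OF count_measurable count_law]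

lemma \<Lambda>_pos: "0 < \<Lambda>"
proof -
  have i: "set_integrable lborel {0..T} lam" by (rule borel_integrable_atLeastAtMost'[OF lam_cont])
  have "\<Lambda> = integral {0..T} lam"
    unfolding \<Lambda>_def by (rule set_borel_integral_eq_integral(2)[OF i])
  moreover have "0 \<le> integral {0..T} lam"
    using lam_pos by (intro integral_nonneg integrable_continuous_interval lam_cont) (auto simp: less_imp_le)
  moreover have "integral {0..T} lam \<noteq> 0"
    using integral_eq_0_iff[OF lam_cont T_pos less_imp_le[OF lam_pos]] lam_pos[of 0] T_pos by auto
  ultimately show ?thesis by simp
qed

lemma value_integral:
  assumes [measurable]: "h \<in> borel_measurable borel"
  shows "expectation (\<lambda>\<omega>. h (X i j \<omega>) :: real) = (\<integral>x. h x \<partial>D)"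
    and "integrable P (\<lambda>\<omega>. h (X i j \<omega>) :: real) \<longleftrightarrow> integrable D h"
  unfolding value_law[of i j, symmetric]
  by (subst integral_distr; simp) (subst integrable_distr_eq; simp)

lemma compound_sum_expectation:
  assumes h [measurable]: "h \<in> borel_measurable borel" and int: "integrable D h"
  shows "integrable P (\<lambda>\<omega>. \<Sum>j<K i \<omega>. h (X i j \<omega>) :: real)"
    and "expectation (\<lambda>\<omega>. \<Sum>j<K i \<omega>. h (X i j \<omega>)) = \<Lambda> * (\<integral>x. h x \<partial>D)"
proof -
  note w = wald[OF count_measurable[of i] count_moments(1), of "\<lambda>j \<omega>. h (X i j \<omega>)" "\<integral>x. h x \<partial>D" "\<integral>x. \<bar>h x\<bar> \<partial>D",
      OF _ _ _ count_independent_of_value[OF h]]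
  have "integrable P (\<lambda>\<omega>. \<Sum>j<K i \<omega>. h (X i j \<omega>)) \<and>
      expectation (\<lambda>\<omega>. \<Sum>j<K i \<omega>. h (X i j \<omega>)) = expectation (\<lambda>\<omega>. real (K i \<omega>)) * (\<integral>x. h x \<partial>D)"
    by (intro conjI w) (simp_all add: value_integral int value_integral(1)[of "\<lambda>x. \<bar>h x\<bar>"])
  then show "integrable P (\<lambda>\<omega>. \<Sum>j<K i \<omega>. h (X i j \<omega>) :: real)"
    "expectation (\<lambda>\<omega>. \<Sum>j<K i \<omega>. h (X i j \<omega>)) = \<Lambda> * (\<integral>x. h x \<partial>D)"
    by (auto simp: count_moments(2))
qed

section \<open>Law of large numbers for the pooled job values\<close>

text \<open>The divisor is the number of realisations, not the number of pooled jobs. The quantity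
  is thus an average of independent compound sums, with mean \<Lambda> times the mean of
  \<open>h\<close>; for \<open>h = 1\<close> it is the number of jobs per realisation.\<close>

definition pooled_average :: "(real \<Rightarrow> real) \<Rightarrow> nat \<Rightarrow> 'w \<Rightarrow> real" where
  "pooled_average h m \<omega> = (\<Sum>i<m. \<Sum>j<K i \<omega>. h (X i j \<omega>)) / real m"

lemma compound_sum_measurable [measurable]:
  assumes [measurable]: "h \<in> borel_measurable borel"
  shows "(\<lambda>\<omega>. \<Sum>j<K i \<omega>. h (X i j \<omega>) :: real) \<in> borel_measurable P"
  by (rule measurable_compose_countable[where f = "\<lambda>m \<omega>. \<Sum>j<m. h (X i j \<omega>)"]) measurable

lemma pooled_average_measurable [measurable]:
  assumes [measurable]: "h \<in> borel_measurable borel"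
  shows "pooled_average h m \<in> borel_measurable P"
  unfolding pooled_average_def[abs_def] by measurable

text \<open>A compound sum is at most \<open>c\<close> times the job count in absolute value, so its
  variance is at most c^2 times the second moment \<Lambda> + \<Lambda>^2 of a Poisson variable;
  then Chebyshev.\<close>

lemma pooled_average_bounded:
  assumes h [measurable]: "h \<in> borel_measurable borel" and c: "\<And>x. \<bar>h x\<bar> \<le> c" and \<eta>: "0 < \<eta>" and m: "0 < m"
  shows "prob {\<omega> \<in> space P. \<eta> \<le> \<bar>pooled_average h m \<omega> - \<Lambda> * (\<integral>x. h x \<partial>D)\<bar>}
    \<le> c\<^sup>2 * (\<Lambda> + \<Lambda>\<^sup>2) / (real m * \<eta>\<^sup>2)"
  unfolding pooled_average_def
proof (rule chebyshev_average[OF _ _ _ _ \<eta> m])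
  show "indep_vars (\<lambda>_. borel) (\<lambda>i \<omega>. \<Sum>j<K i \<omega>. h (X i j \<omega>)) UNIV"
    by (rule independent_compound_sums) measurable
  have int: "integrable D h"
    by (rule D.integrable_const_bound[where B = c]) (use c in auto)
  note e = compound_sum_expectation[OF h int]
  show "expectation (\<lambda>\<omega>. \<Sum>j<K i \<omega>. h (X i j \<omega>)) = \<Lambda> * (\<integral>x. h x \<partial>D)" for i by (rule e(2))
  have le: "(\<Sum>j<K i \<omega>. h (X i j \<omega>))\<^sup>2 \<le> c\<^sup>2 * (real (K i \<omega>))\<^sup>2" for i \<omega>
  proof -
    have "\<bar>\<Sum>j<K i \<omega>. h (X i j \<omega>)\<bar> \<le> (\<Sum>j<K i \<omega>. c)"
      using c by (intro order_trans[OF sum_abs] sum_mono) auto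
    then have "\<bar>\<Sum>j<K i \<omega>. h (X i j \<omega>)\<bar>\<^sup>2 \<le> (\<Sum>j<K i \<omega>. c)\<^sup>2" by (intro power_mono) auto
    then show ?thesis by (simp add: power_mult_distrib mult.commute)
  qed
  have intK: "integrable P (\<lambda>\<omega>. c\<^sup>2 * (real (K i \<omega>))\<^sup>2)" for i
    using count_moments(3) by (rule integrable_mult_right)
  show sq: "integrable P (\<lambda>\<omega>. (\<Sum>j<K i \<omega>. h (X i j \<omega>))\<^sup>2)" for i
    by (rule Bochner_Integration.integrable_bound[OF intK[of i]]) (use le in auto)
  show "variance (\<lambda>\<omega>. \<Sum>j<K i \<omega>. h (X i j \<omega>)) \<le> c\<^sup>2 * (\<Lambda> + \<Lambda>\<^sup>2)" for i
  proof -
    have "variance (\<lambda>\<omega>. \<Sum>j<K i \<omega>. h (X i j \<omega>)) \<le> expectation (\<lambda>\<omega>. (\<Sum>j<K i \<omega>. h (X i j \<omega>))\<^sup>2)"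
      by (subst variance_eq[OF e(1) sq]) simp
    also have "\<dots> \<le> expectation (\<lambda>\<omega>. c\<^sup>2 * (real (K i \<omega>))\<^sup>2)"
      by (rule integral_mono[OF sq intK le])
    also have "\<dots> = c\<^sup>2 * (\<Lambda> + \<Lambda>\<^sup>2)" by (simp add: count_moments(4))
    finally show ?thesis .
  qed
qed

text \<open>Here \<open>g\<close> has only a first moment. The truncation min g c is bounded and
  falls under Chebyshev; the remainder is nonnegative with small mean and falls under
  Markov.\<close>

lemma whp_pooled_average:
  assumes g [measurable]: "g \<in> borel_measurable borel" and g0: "\<And>x. 0 \<le> g x" and int: "integrable D g"
    and \<eta>: "0 < \<eta>"
  shows "whp (\<lambda>m \<omega>. \<bar>pooled_average g m \<omega> - \<Lambda> * (\<integral>x. g x \<partial>D)\<bar> < \<eta>)"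
proof (rule whpI[where B = "\<lambda>m. {\<omega> \<in> space P. \<eta> \<le> \<bar>pooled_average g m \<omega> - \<Lambda> * (\<integral>x. g x \<partial>D)\<bar>}" and ?m0.0 = 0])
  define h where "h c x = min (g x) (real c)" for c x
  define r where "r c x = g x - h c x" for c x
  have hm [measurable]: "h c \<in> borel_measurable borel" for c unfolding h_def[abs_def] by measurable
  have rm [measurable]: "r c \<in> borel_measurable borel" for c unfolding r_def[abs_def] by measurable
  have h0: "\<bar>h c x\<bar> \<le> real c" and r0: "0 \<le> r c x" and rg: "r c x \<le> g x" for c x
    using g0[of x] by (auto simp: h_def r_def)
  have inth: "integrable D (h c)" for c
    by (rule D.integrable_const_bound[where B = "real c"]) (use h0 in auto)
  have intr: "integrable D (r c)" for c
    unfolding r_def[abs_def] using int inth by (rule Bochner_Integration.integrable_diff)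
  have lim: "(\<lambda>c. \<integral>x. r c x \<partial>D) \<longlonglongrightarrow> (\<integral>x. 0 \<partial>D)"
  proof (rule integral_dominated_convergence[OF _ _ int])
    show "AE x in D. (\<lambda>c. r c x) \<longlonglongrightarrow> 0"
    proof (rule AE_I2)
      fix x
      have "\<forall>\<^sub>F c in sequentially. g x \<le> real c" by real_asymp
      then have "\<forall>\<^sub>F c in sequentially. r c x = 0" by eventually_elim (simp add: r_def h_def)
      then show "(\<lambda>c. r c x) \<longlonglongrightarrow> 0" by (rule tendsto_eventually)
    qed
    show "AE x in D. norm (r c x) \<le> g x" for c using r0 rg by simp
  qed auto
  show "(\<lambda>m. prob {\<omega> \<in> space P. \<eta> \<le> \<bar>pooled_average g m \<omega> - \<Lambda> * (\<integral>x. g x \<partial>D)\<bar>}) \<longlonglongrightarrow> 0"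
  proof (rule LIMSEQ_I)
    fix e :: real assume e: "0 < e"
    have "(\<lambda>c. \<Lambda> * (\<integral>x. r c x \<partial>D)) \<longlonglongrightarrow> \<Lambda> * 0" using lim by (intro tendsto_mult_left) simp
    \<comment> \<open>The first bound makes the mean of the remainder negligible when \<eta> is
      split into thirds; the second gives e / 2 after Markov's inequality has divided by \<eta> /
      3.\<close>
    then have "\<forall>\<^sub>F c in sequentially. \<Lambda> * (\<integral>x. r c x \<partial>D) < min (\<eta> / 3) (e * \<eta> / 6)"
      using e \<eta> by (intro order_tendstoD(2)) auto
    then obtain c where c: "\<Lambda> * (\<integral>x. r c x \<partial>D) < \<eta> / 3" "\<Lambda> * (\<integral>x. r c x \<partial>D) < e * \<eta> / 6"
      by (auto simp: eventually_sequentially)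
    define V where "V = (real c)\<^sup>2 * (\<Lambda> + \<Lambda>\<^sup>2) / (\<eta> / 3)\<^sup>2"
    have "(\<lambda>m. V / real m) \<longlonglongrightarrow> 0" by real_asymp
    then have "\<forall>\<^sub>F m in sequentially. V / real m < e / 2" using e by (intro order_tendstoD(2)) auto
    then obtain m0 where m0: "\<And>m. m \<ge> m0 \<Longrightarrow> V / real m < e / 2" by (auto simp: eventually_sequentially)
    have "prob {\<omega> \<in> space P. \<eta> \<le> \<bar>pooled_average g m \<omega> - \<Lambda> * (\<integral>x. g x \<partial>D)\<bar>} < e" if m: "m \<ge> max 1 m0" for m
    proof -
      let ?H = "{\<omega> \<in> space P. \<eta> / 3 \<le> \<bar>pooled_average (h c) m \<omega> - \<Lambda> * (\<integral>x. h c x \<partial>D)\<bar>}"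
      let ?R = "{\<omega> \<in> space P. \<eta> / 3 \<le> pooled_average (r c) m \<omega>}"
      have split: "pooled_average g m \<omega> = pooled_average (h c) m \<omega> + pooled_average (r c) m \<omega>" for \<omega>
        by (simp add: pooled_average_def r_def sum_subtractf diff_divide_distrib)
      have isplit: "(\<integral>x. g x \<partial>D) = (\<integral>x. h c x \<partial>D) + (\<integral>x. r c x \<partial>D)"
        unfolding r_def using int inth by simp
      have r_nn: "0 \<le> pooled_average (r c) m \<omega>" for \<omega>
        unfolding pooled_average_def using r0 by (intro divide_nonneg_nonneg sum_nonneg) auto
      have L0: "0 \<le> \<Lambda> * (\<integral>x. r c x \<partial>D)" using \<Lambda>_pos r0 by simp
      have "{\<omega> \<in> space P. \<eta> \<le> \<bar>pooled_average g m \<omega> - \<Lambda> * (\<integral>x. g x \<partial>D)\<bar>} \<subseteq> ?H \<union> ?R"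
      proof
        fix \<omega> assume \<omega>: "\<omega> \<in> {\<omega> \<in> space P. \<eta> \<le> \<bar>pooled_average g m \<omega> - \<Lambda> * (\<integral>x. g x \<partial>D)\<bar>}"
        then have "\<eta> \<le> \<bar>(pooled_average (h c) m \<omega> - \<Lambda> * (\<integral>x. h c x \<partial>D))
            + (pooled_average (r c) m \<omega> - \<Lambda> * (\<integral>x. r c x \<partial>D))\<bar>"
          unfolding split isplit distrib_left by (simp add: algebra_simps)
        \<comment> \<open>The remainder and its mean are both nonnegative and the mean is below
          \<eta> / 3, so a deviation of at least \<eta> must show in the truncated part or in the
          remainder itself.\<close>
        then have "\<eta> / 3 \<le> \<bar>pooled_average (h c) m \<omega> - \<Lambda> * (\<integral>x. h c x \<partial>D)\<bar> \<or> \<eta> / 3 \<le> pooled_average (r c) m \<omega>"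
          using c(1) L0 r_nn[of \<omega>] by linarith
        then show "\<omega> \<in> ?H \<union> ?R" using \<omega> by auto
      qed
      then have "prob {\<omega> \<in> space P. \<eta> \<le> \<bar>pooled_average g m \<omega> - \<Lambda> * (\<integral>x. g x \<partial>D)\<bar>} \<le> prob (?H \<union> ?R)"
        by (intro finite_measure_mono) auto
      also have "\<dots> \<le> prob ?H + prob ?R" by (intro measure_Un_le) auto
      also have "prob ?H \<le> V / real m"
        using pooled_average_bounded[OF hm h0, of "\<eta> / 3" m] \<eta> m by (simp add: V_def mult.commute)
      also have "prob ?R \<le> expectation (pooled_average (r c) m) / (\<eta> / 3)"
        using \<eta> r_nn compound_sum_expectation(1)[OF rm intr]
        by (intro integral_Markov_inequality_measure[where A = "{}"])
          (auto simp: pooled_average_def[abs_def] intro!: integrable_divide_zero Bochner_Integration.integrable_sum)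
      also have "expectation (pooled_average (r c) m) = \<Lambda> * (\<integral>x. r c x \<partial>D)"
        using compound_sum_expectation[OF rm intr] m by (simp add: pooled_average_def[abs_def] Bochner_Integration.integral_sum)
      also have "\<dots> / (\<eta> / 3) < e / 2" using c(2) \<eta> by (simp add: field_simps)
      also have "V / real m + e / 2 < e" 
      proof -
        have "V / real m < e / 2" by (rule m0) (use m in simp)
        then show ?thesis by linarith
      qed
      finally show ?thesis by simp
    qed
    then show "\<exists>m0. \<forall>m\<ge>m0. norm (prob {\<omega> \<in> space P. \<eta> \<le> \<bar>pooled_average g m \<omega> - \<Lambda> * (\<integral>x. g x \<partial>D)\<bar>} - 0) < e"
      by (intro exI[of _ "max 1 m0"]) auto
  qed
qed (use assms in auto)

end

subsection \<open>Consistency of the estimates\<close>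

text \<open>Each sample x_j contributes the length of [y, x_j), that is (x_j - y)^+, to the integral
  of 1 - F_N; so the estimate is the shortage of the empirical law. For an empty list both sides are
  0, since division by 0 gives 0.\<close>

lemma mean_shortage_estimate_eq:
  "mean_shortage_estimate rs y =
    (\<Sum>j<length (pooled_values rs). max (pooled_values rs ! j - y) 0) / real (length (pooled_values rs))"
proof (cases "pooled_values rs = []")
  case True
  then show ?thesis by (simp add: mean_shortage_estimate_def)
next
  case False
  define xs where "xs = pooled_values rs"
  have xs: "xs \<noteq> []" using False by (simp add: xs_def)
  have cdf: "1 - empirical_cdf xs x = (\<Sum>j<length xs. indicator {..<xs ! j} x) / real (length xs)" for x
  proof -
    have "real (length (filter (\<lambda>v. v \<le> x) xs)) = (\<Sum>j<length xs. of_bool (xs ! j \<le> x))"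
      by (simp add: length_filter_conv_card of_bool_def sum.If_cases Int_def)
    moreover have "real (length xs) - (\<Sum>j<length xs. of_bool (xs ! j \<le> x)) = (\<Sum>j<length xs. indicator {..<xs ! j} x)"
    proof -
      have "(\<Sum>j<length xs. of_bool (xs ! j \<le> x)) + (\<Sum>j<length xs. indicator {..<xs ! j} x) = (\<Sum>j<length xs. (1::real))"
        unfolding sum.distrib[symmetric] by (intro sum.cong) (auto simp: indicator_def)
      then show ?thesis by simp
    qed
    moreover have "1 - a / real (length xs) = (real (length xs) - a) / real (length xs)" for a
      using xs by (simp add: field_simps)
    ultimately show ?thesis unfolding empirical_cdf_def by simp
  qed
  have eq: "indicator {y..} x *\<^sub>R (1 - empirical_cdf xs x) = (\<Sum>j<length xs. indicator {y..<xs ! j} x) / real (length xs)" for x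
    unfolding cdf by (auto simp: indicator_def intro!: arg_cong[where f = "\<lambda>s. s / _"] sum.cong)
  have int: "integrable lborel (\<lambda>x. indicator {y..<a} x :: real)" for a
    by (cases "y \<le> a") (auto intro!: integrable_real_indicator)
  have "(\<integral>x. indicator {y..<a} x \<partial>lborel) = max (a - y) 0" for a
    by (cases "y \<le> a") auto
  then have "(LINT x:{y..}|lborel. 1 - empirical_cdf xs x) = (\<Sum>j<length xs. max (xs ! j - y) 0) / real (length xs)"
    unfolding set_lebesgue_integral_def eq using int by (simp add: Bochner_Integration.integral_sum)
  then show ?thesis using xs unfolding mean_shortage_estimate_def xs_def by (simp add: Let_def)
qed

lemma mean_shortage_estimate_nonneg: "0 \<le> mean_shortage_estimate rs y"
  unfolding mean_shortage_estimate_eq by (intro divide_nonneg_nonneg sum_nonneg) auto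

lemma mean_shortage_estimate_antimono:
  "a \<le> b \<Longrightarrow> mean_shortage_estimate rs b \<le> mean_shortage_estimate rs a"
  unfolding mean_shortage_estimate_eq by (intro divide_right_mono sum_mono) auto

lemma mean_shortage_estimate_lipschitz:
  "\<bar>mean_shortage_estimate rs a - mean_shortage_estimate rs b\<bar> \<le> \<bar>a - b\<bar>"
proof (cases "pooled_values rs = []")
  case False
  let ?x = "pooled_values rs"
  have "\<bar>(\<Sum>j<length ?x. max (?x ! j - a) 0) - (\<Sum>j<length ?x. max (?x ! j - b) 0)\<bar>
      \<le> (\<Sum>j<length ?x. \<bar>a - b\<bar>)"
    unfolding sum_subtractf[symmetric] by (intro order_trans[OF sum_abs] sum_mono) auto
  then show ?thesis
    unfolding mean_shortage_estimate_eq diff_divide_distrib[symmetric] using False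
    by (simp add: abs_divide divide_le_eq mult.commute)
qed (simp add: mean_shortage_estimate_eq)

lemma floor_divide_eq:
  assumes "0 < d" shows "\<lfloor>t / d\<rfloor> = b \<longleftrightarrow> of_int b * d \<le> t \<and> t < of_int b * d + (d::real)"
  using assms by (simp add: floor_eq_iff pos_le_divide_eq pos_divide_less_eq distrib_right)

context npsa_sample
begin

definition data :: "nat \<Rightarrow> 'w \<Rightarrow> (real \<times> real) list list" where
  "data m \<omega> = map (\<lambda>i. job_list (K i) (X i) (A i) \<omega>) [0..<m]"

lemma sum_pooled_data:
  "(\<Sum>j<length (pooled_values (data m \<omega>)). h (pooled_values (data m \<omega>) ! j)) = (\<Sum>i<m. \<Sum>j<K i \<omega>. h (X i j \<omega>) :: real)"
proof -
  have "(\<Sum>v\<leftarrow>pooled_values (data m \<omega>). h v) = (\<Sum>i<m. \<Sum>j<K i \<omega>. h (X i j \<omega>))"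
  proof (induction m)
    case (Suc m)
    have "(\<Sum>v\<leftarrow>map fst (job_list (K m) (X m) (A m) \<omega>). h v) = (\<Sum>j<K m \<omega>. h (X m j \<omega>))"
      by (simp add: job_list_def comp_def interv_sum_list_conv_sum_set_nat atLeast0LessThan)
    with Suc show ?case by (simp add: pooled_values_def data_def)
  qed (simp add: pooled_values_def data_def)
  then show ?thesis by (simp add: sum_list_sum_nth atLeast0LessThan)
qed

lemma length_pooled_data: "real (length (pooled_values (data m \<omega>))) = (\<Sum>i<m. real (K i \<omega>))"
  using sum_pooled_data[of "\<lambda>_. 1" m \<omega>] by simp

text \<open>Dividing numerator and denominator by the number of realisations gives each of them a
  limit: \<Lambda>\<phi>(y) and \<Lambda>.\<close>

lemma mean_shortage_estimate_data:
  assumes "1 \<le> m"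
  shows "mean_shortage_estimate (data m \<omega>) y
    = pooled_average (\<lambda>x. max (x - y) 0) m \<omega> / pooled_average (\<lambda>_. 1) m \<omega>"
  using assms sum_pooled_data[of "\<lambda>x. max (x - y) 0" m \<omega>]
  by (simp add: mean_shortage_estimate_eq length_pooled_data pooled_average_def)

lemma whp_mean_shortage_estimate:
  assumes \<eta>: "0 < \<eta>"
  shows "whp (\<lambda>m \<omega>. \<bar>mean_shortage_estimate (data m \<omega>) y - mean_shortage f y\<bar> \<le> \<eta>)"
proof -
  define G where "G = mean_shortage f y"
  have G: "0 \<le> G" unfolding G_def by (rule mean_shortage_nonneg)
  \<comment> \<open>The first bound keeps the denominator above \<Lambda> / 2; the second then makes
    the quotient error, at most (\<gamma> + G\<gamma>) / (\<Lambda> / 2), not exceed \<eta>.\<close>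
  define \<gamma> where "\<gamma> = min (\<Lambda> / 2) (\<eta> * \<Lambda> / (2 * (1 + G)))"
  have \<gamma>: "0 < \<gamma>" unfolding \<gamma>_def using \<Lambda>_pos \<eta> G by simp
  have "whp (\<lambda>m \<omega>. \<bar>pooled_average (\<lambda>x. max (x - y) 0) m \<omega> - \<Lambda> * G\<bar> < \<gamma>)"
    unfolding G_def mean_shortage_eq using \<gamma> by (intro whp_pooled_average shortage_integrable) auto
  moreover have "whp (\<lambda>m \<omega>. \<bar>pooled_average (\<lambda>_. 1) m \<omega> - \<Lambda> * (\<integral>x. 1 \<partial>D)\<bar> < \<gamma>)"
    using \<gamma> by (intro whp_pooled_average) auto
  ultimately have "whp (\<lambda>m \<omega>. \<bar>pooled_average (\<lambda>x. max (x - y) 0) m \<omega> - \<Lambda> * G\<bar> < \<gamma> \<and>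
      \<bar>pooled_average (\<lambda>_. 1) m \<omega> - \<Lambda> * (\<integral>x. 1 \<partial>D)\<bar> < \<gamma>)" by (rule whp_conj)
  then show ?thesis
  proof (rule whp_mono[where ?m0.0 = 1])
    fix m \<omega>
    assume m: "1 \<le> m" and "\<bar>pooled_average (\<lambda>x. max (x - y) 0) m \<omega> - \<Lambda> * G\<bar> < \<gamma> \<and>
      \<bar>pooled_average (\<lambda>_. 1) m \<omega> - \<Lambda> * (\<integral>x. 1 \<partial>D)\<bar> < \<gamma>"
    moreover define a where "a = pooled_average (\<lambda>x. max (x - y) 0) m \<omega>"
    moreover define b where "b = pooled_average (\<lambda>_. 1) m \<omega>"
    moreover have "(\<integral>x. 1 \<partial>D) = (1 :: real)" using D.prob_space by simp
    ultimately have a: "\<bar>a - \<Lambda> * G\<bar> \<le> \<gamma>" and b: "\<bar>b - \<Lambda>\<bar> \<le> \<gamma>" by auto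
    have bL: "\<Lambda> / 2 \<le> b" using b unfolding \<gamma>_def by linarith
    then have b0: "0 < b" using \<Lambda>_pos by linarith
    have "\<bar>a / b - G\<bar> = \<bar>(a - \<Lambda> * G) - G * (b - \<Lambda>)\<bar> / b"
    proof -
      have "a / b - G = ((a - \<Lambda> * G) - G * (b - \<Lambda>)) / b" using b0 by (simp add: field_simps)
      then show ?thesis using b0 by (simp add: abs_divide)
    qed
    also have "\<dots> \<le> (\<gamma> + G * \<gamma>) / b"
    proof (rule divide_right_mono)
      have "\<bar>G * (b - \<Lambda>)\<bar> \<le> G * \<gamma>" using G b by (simp add: abs_mult mult_left_mono)
      then show "\<bar>(a - \<Lambda> * G) - G * (b - \<Lambda>)\<bar> \<le> \<gamma> + G * \<gamma>" using a by linarith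
    qed (use b0 in simp)
    also have "\<dots> \<le> (\<gamma> + G * \<gamma>) / (\<Lambda> / 2)"
      using bL \<Lambda>_pos \<gamma> G by (intro divide_left_mono) auto
    also have "\<dots> = \<gamma> * (2 * (1 + G)) / \<Lambda>" by (simp add: field_simps)
    also have "\<dots> \<le> (\<eta> * \<Lambda> / (2 * (1 + G))) * (2 * (1 + G)) / \<Lambda>"
      using \<Lambda>_pos G unfolding \<gamma>_def by (intro divide_right_mono mult_right_mono) auto
    also have "\<dots> = \<eta>" using \<Lambda>_pos G by simp
    finally show "\<bar>mean_shortage_estimate (data m \<omega>) y - mean_shortage f y\<bar> \<le> \<eta>"
      unfolding mean_shortage_estimate_data[OF m] a_def b_def G_def .
  qed
qed

lemma whp_mean_shortage_estimate_uniform: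
  assumes \<eta>: "0 < \<eta>"
  shows "whp (\<lambda>m \<omega>. \<forall>y\<ge>0. \<bar>mean_shortage_estimate (data m \<omega>) y - mean_shortage f y\<bar> \<le> \<eta>)"
proof -
  \<comment> \<open>One third for the error at a grid point and one for each function's change over
    a grid step, both being 1-Lipschitz.\<close>
  define h where "h = \<eta> / 3"
  have h: "0 < h" using \<eta> by (simp add: h_def)
  have "\<forall>\<^sub>F y in at_top. mean_shortage f y < h"
    using mean_shortage_tendsto_0 h by (rule order_tendstoD)
  then obtain Y where Y: "\<And>y. Y \<le> y \<Longrightarrow> mean_shortage f y < h" by (auto simp: eventually_at_top_linorder)
  define N where "N = nat \<lceil>Y / h\<rceil>"
  have "Y / h \<le> real N" unfolding N_def by linarith
  then have N: "Y \<le> real N * h" using h by (simp add: divide_le_eq)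
  have "whp (\<lambda>m \<omega>. \<forall>k\<in>{..N}. \<bar>mean_shortage_estimate (data m \<omega>) (real k * h) - mean_shortage f (real k * h)\<bar> \<le> h)"
    using h by (intro whp_ball whp_mean_shortage_estimate) auto
  then show ?thesis
  proof (rule whp_mono[where ?m0.0 = 0])
    fix m \<omega>
    let ?\<phi> = "mean_shortage_estimate (data m \<omega>)"
    assume grid: "\<forall>k\<in>{..N}. \<bar>?\<phi> (real k * h) - mean_shortage f (real k * h)\<bar> \<le> h"
    show "\<forall>y\<ge>0. \<bar>?\<phi> y - mean_shortage f y\<bar> \<le> \<eta>"
    proof (intro allI impI)
      fix y :: real assume y: "0 \<le> y"
      show "\<bar>?\<phi> y - mean_shortage f y\<bar> \<le> \<eta>"
      proof (cases "y \<le> real N * h")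
        case True
        define k where "k = nat \<lfloor>y / h\<rfloor>"
        have k: "real k \<le> y / h" "y / h \<le> real k + 1" unfolding k_def using y h by (auto simp: floor_le_iff)
        then have "real k * h \<le> y" "y \<le> real k * h + h" using h by (auto simp: field_simps)
        then have "\<bar>y - real k * h\<bar> \<le> h" by auto
        moreover have "real k \<le> real N" using k(1) True h by (meson divide_le_eq order_trans)
        then have "\<bar>?\<phi> (real k * h) - mean_shortage f (real k * h)\<bar> \<le> h" using grid by simp
        ultimately show ?thesis
          using mean_shortage_estimate_lipschitz[of "data m \<omega>" y "real k * h"]
            mean_shortage_lipschitz[of y "real k * h"] unfolding h_def by linarith
      next
        case False
        \<comment> \<open>Beyond the grid both functions are small: the estimate is antitone, so it
          stays below its value at the last grid point, which is less than 2h.\<close>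
        have "?\<phi> y \<le> ?\<phi> (real N * h)" using False by (intro mean_shortage_estimate_antimono) simp
        moreover have "\<bar>?\<phi> (real N * h) - mean_shortage f (real N * h)\<bar> \<le> h" using grid by simp
        moreover have "mean_shortage f (real N * h) < h" "mean_shortage f y < h" using Y N False by auto
        ultimately show ?thesis
          using mean_shortage_nonneg[of y] mean_shortage_estimate_nonneg[of "data m \<omega>" y]
          unfolding h_def by linarith
      qed
    qed
  qed
qed

section \<open>Sampling error and bias of the binned intensity estimate\<close>

text \<open>Intersecting with \<open>{0..T}\<close> makes the Poisson law applicable to a bin that
  sticks out at \<open>T\<close>; it changes no count, as all arrivals lie in
  \<open>{0..T}\<close>.\<close>

definition bin :: "nat \<Rightarrow> int \<Rightarrow> real set" where
  "bin m b = {t \<in> {0..T}. \<lfloor>t / bin_width T m\<rfloor> = b}"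

lemma bin_width_pos: "1 \<le> m \<Longrightarrow> 0 < bin_width T m"
  using T_pos by (simp add: bin_width_def)

lemma bin_sets [measurable]: "bin m b \<in> sets borel"
proof -
  have "{t \<in> space borel. 0 \<le> t \<and> t \<le> T \<and> \<lfloor>t / bin_width T m\<rfloor> = b} \<in> sets borel" by measurable
  then show ?thesis by (simp add: bin_def conj_assoc)
qed

lemma bin_subset: "bin m b \<subseteq> {0..T}"
  by (auto simp: bin_def)

lemma intensity_estimate_data:
  assumes m: "1 \<le> m" and \<omega>: "\<omega> \<in> space P"
  shows "intensity_estimate T (data m \<omega>) t
    = (\<Sum>i<m. real (arrivals_in (bin m \<lfloor>t / bin_width T m\<rfloor>) (K i) (A i) \<omega>)) / real m / bin_width T m"
proof -
  let ?d = "bin_width T m" and ?b = "\<lfloor>t / bin_width T m\<rfloor>"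
  have d: "0 < ?d" by (rule bin_width_pos[OF m])
  have "arrival_count (of_int ?b * ?d) (of_int ?b * ?d + ?d) (job_list (K i) (X i) (A i) \<omega>)
      = arrivals_in (bin m ?b) (K i) (A i) \<omega>" for i
  proof -
    have "arrival_count (of_int ?b * ?d) (of_int ?b * ?d + ?d) (job_list (K i) (X i) (A i) \<omega>)
        = card {j. j < K i \<omega> \<and> of_int ?b * ?d \<le> A i j \<omega> \<and> A i j \<omega> < of_int ?b * ?d + ?d}"
      by (simp add: arrival_count_def job_list_def filter_map comp_def length_filter_conv_card cong: conj_cong)
    also have "\<dots> = arrivals_in (bin m ?b) (K i) (A i) \<omega>"
      unfolding arrivals_in_def bin_def
      using arrival_times[OF \<omega>] floor_divide_eq[OF d] by (intro arg_cong[where f = card]) auto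
    finally show ?thesis .
  qed
  then show ?thesis using m by (simp add: intensity_estimate_def Let_def data_def bin_start_def)
qed

lemma lam_integrable_on:
  assumes "B \<in> sets borel" "B \<subseteq> {0..T}"
  shows "set_integrable lborel B lam"
  using borel_integrable_atLeastAtMost'[OF lam_cont] by (rule set_integrable_subset) (use assms in auto)

definition "bin_mean m b = (LINT t:bin m b|lborel. lam t)"

lemma bin_mean_bounds:
  assumes m: "1 \<le> m"
  shows "0 \<le> bin_mean m b" "bin_mean m b \<le> L * bin_width T m"
proof -
  let ?d = "bin_width T m"
  have d: "0 < ?d" by (rule bin_width_pos[OF m])
  have le: "indicator (bin m b) t * lam t \<le> L * indicator {of_int b * ?d..of_int b * ?d + ?d} t"
    and nn: "0 \<le> indicator (bin m b) t * lam t" for t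
    using lam_le_L[of t] lam_pos[of t] L_pos floor_divide_eq[OF d, of t b]
    by (auto simp: bin_def indicator_def)
  show "0 \<le> bin_mean m b"
    unfolding bin_mean_def set_lebesgue_integral_def using nn by (intro integral_nonneg_AE) auto
  have "bin_mean m b \<le> (\<integral>t. L * indicator {of_int b * ?d..of_int b * ?d + ?d} t \<partial>lborel)"
    unfolding bin_mean_def set_lebesgue_integral_def real_scaleR_def
    using lam_integrable_on[OF bin_sets bin_subset, of m b]
    by (intro integral_mono le integrable_mult_right integrable_real_indicator)
       (auto simp: set_integrable_def emeasure_lborel_Icc_eq)
  also have "\<dots> = L * ?d" using d by simp
  finally show "bin_mean m b \<le> L * ?d" .
qed

lemma bin_mean_approx:
  assumes m: "1 \<le> m" and t: "t \<in> {0..T}" "t \<le> T - bin_width T m"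
    and mod: "\<And>s. s \<in> {0..T} \<Longrightarrow> \<bar>s - t\<bar> \<le> bin_width T m \<Longrightarrow> \<bar>lam s - lam t\<bar> \<le> \<eta>"
  shows "\<bar>bin_mean m \<lfloor>t / bin_width T m\<rfloor> - bin_width T m * lam t\<bar> \<le> bin_width T m * \<eta>"
proof -
  let ?d = "bin_width T m" and ?b = "\<lfloor>t / bin_width T m\<rfloor>"
  have d: "0 < ?d" by (rule bin_width_pos[OF m])
  note tb = floor_divide_eq[OF d, of t ?b, simplified]
  have b0: "0 \<le> ?b" using t d by simp
  \<comment> \<open>Since \<open>t\<close> is at least one width before \<open>T\<close>, its bin
    ends by \<open>T\<close> and is not cut off.\<close>
  have bin: "bin m ?b = {of_int ?b * ?d..<of_int ?b * ?d + ?d}"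
  proof
    show "bin m ?b \<subseteq> {of_int ?b * ?d..<of_int ?b * ?d + ?d}"
      using floor_divide_eq[OF d] by (auto simp: bin_def)
    show "{of_int ?b * ?d..<of_int ?b * ?d + ?d} \<subseteq> bin m ?b"
    proof
      fix s assume s: "s \<in> {of_int ?b * ?d..<of_int ?b * ?d + ?d}"
      have "0 \<le> of_int ?b * ?d" using b0 d by simp
      then have "0 \<le> s" "s \<le> T" using s tb t by auto
      then show "s \<in> bin m ?b" using s floor_divide_eq[OF d, of s ?b] by (simp add: bin_def)
    qed
  qed
  have int: "integrable lborel (\<lambda>s. indicator (bin m ?b) s :: real)"
    unfolding bin using d by (intro integrable_real_indicator) auto
  have "(\<integral>s. indicator (bin m ?b) s \<partial>lborel) = ?d" unfolding bin using d by simp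
  then have one: "(\<integral>s. indicator (bin m ?b) s * c \<partial>lborel) = ?d * c" for c :: real by simp
  have lamint: "integrable lborel (\<lambda>s. indicator (bin m ?b) s * lam s)"
    using lam_integrable_on[OF bin_sets bin_subset, of m ?b] by (simp add: set_integrable_def)
  have eq: "bin_mean m ?b - ?d * lam t = (\<integral>s. indicator (bin m ?b) s * lam s - indicator (bin m ?b) s * lam t \<partial>lborel)"
  proof -
    have "(\<integral>s. indicator (bin m ?b) s * lam s - indicator (bin m ?b) s * lam t \<partial>lborel)
        = (\<integral>s. indicator (bin m ?b) s * lam s \<partial>lborel) - (\<integral>s. indicator (bin m ?b) s * lam t \<partial>lborel)"
      using int by (intro Bochner_Integration.integral_diff lamint) simp
    then show ?thesis unfolding one by (simp add: bin_mean_def set_lebesgue_integral_def)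
  qed
  have "\<bar>bin_mean m ?b - ?d * lam t\<bar>
      \<le> (\<integral>s. \<bar>indicator (bin m ?b) s * lam s - indicator (bin m ?b) s * lam t\<bar> \<partial>lborel)"
    unfolding eq by (rule integral_abs_bound)
  also have "\<dots> \<le> (\<integral>s. indicator (bin m ?b) s * \<eta> \<partial>lborel)"
  proof (rule integral_mono)
    fix s
    show "\<bar>indicator (bin m ?b) s * lam s - indicator (bin m ?b) s * lam t\<bar> \<le> indicator (bin m ?b) s * \<eta>"
    proof (cases "s \<in> bin m ?b")
      case True
      have "of_int ?b * ?d \<le> s \<and> s < of_int ?b * ?d + ?d" using True unfolding bin by simp
      then have "\<bar>s - t\<bar> \<le> ?d" using tb by linarith
      moreover have "s \<in> {0..T}" using True bin_subset by blast
      ultimately show ?thesis using mod True by simp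
    qed simp
  qed (use lamint int in auto)
  also have "\<dots> = ?d * \<eta>" by (rule one)
  finally show ?thesis .
qed

text \<open>The variance of a Poisson count is its mean, at most L\<delta>, so Chebyshev bounds the
  failure of one bin by L / (m \<delta> \<eta>^2). Comparison is with the bin's own mean, which
  separates the random error from the bias.\<close>

lemma whp_bin_counts:
  assumes \<eta>: "0 < \<eta>"
  shows "whp (\<lambda>m \<omega>. \<forall>t\<in>{0..T}. \<bar>intensity_estimate T (data m \<omega>) t - bin_mean m \<lfloor>t / bin_width T m\<rfloor> / bin_width T m\<bar> \<le> \<eta>)"
proof (rule whpI[where ?m0.0 = 1])
  let ?d = "bin_width T"
  define avg where "avg m b \<omega> = (\<Sum>i<m. real (arrivals_in (bin m b) (K i) (A i) \<omega>)) / real m" for m b \<omega>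
  \<comment> \<open>One index more than the integer part of m^(1/3), because the bin containing
    \<open>T\<close> counts as well.\<close>
  define I where "I m = {0..\<lfloor>T / ?d m\<rfloor>}" for m
  define E where "E m b = {\<omega> \<in> space P. \<eta> * ?d m \<le> \<bar>avg m b \<omega> - bin_mean m b\<bar>}" for m b
  have E: "E m b \<in> events" for m b unfolding E_def avg_def by measurable
  show "(\<Union>b\<in>I m. E m b) \<in> events" for m using E by (intro sets.finite_UN) (auto simp: I_def)
  have single: "prob (E m b) \<le> L / (real m * ?d m * \<eta>\<^sup>2)" if m: "1 \<le> m" for m b
  proof -
    have d: "0 < ?d m" by (rule bin_width_pos[OF m])
    note mom = poisson_moments[OF arrivals_measurable[OF bin_sets[of m b]] arrivals_law[OF bin_sets[of m b] bin_subset],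
        folded bin_mean_def]
    have "prob (E m b) \<le> bin_mean m b / (real m * (\<eta> * ?d m)\<^sup>2)"
      unfolding E_def avg_def
    proof (rule chebyshev_average)
      have "indep_vars (\<lambda>_. borel) (\<lambda>i \<omega>. \<Sum>j<K i \<omega>. of_bool (A i j \<omega> \<in> bin m b) :: real) UNIV"
        using independent_compound_sums[of "\<lambda>_ a. of_bool (a \<in> bin m b)"] by measurable
      then show "indep_vars (\<lambda>_. borel) (\<lambda>i \<omega>. real (arrivals_in (bin m b) (K i) (A i) \<omega>)) UNIV"
        by (simp add: arrivals_in_def of_bool_def sum.If_cases Int_def)
      show "variance (\<lambda>\<omega>. real (arrivals_in (bin m b) (K i) (A i) \<omega>)) \<le> bin_mean m b" for i
        by (subst variance_eq[OF mom(1) mom(3)]) (simp add: mom)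
    qed (use mom \<eta> d m in auto)
    also have "\<dots> \<le> (L * ?d m) / (real m * (\<eta> * ?d m)\<^sup>2)"
      using bin_mean_bounds(2)[OF m] by (intro divide_right_mono) auto
    also have "\<dots> = L / (real m * ?d m * \<eta>\<^sup>2)"
      using d m \<eta> by (simp add: power2_eq_square field_simps)
    finally show ?thesis .
  qed
  have total: "prob (\<Union>b\<in>I m. E m b) \<le> (real m powr (1/3) + 1) * (L / (real m * ?d m * \<eta>\<^sup>2))" if m: "1 \<le> m" for m
  proof -
    have d: "0 < ?d m" by (rule bin_width_pos[OF m])
    have "prob (\<Union>b\<in>I m. E m b) \<le> (\<Sum>b\<in>I m. prob (E m b))"
      using E by (intro finite_measure_subadditive_finite) (auto simp: I_def)
    also have "\<dots> \<le> real (card (I m)) * (L / (real m * ?d m * \<eta>\<^sup>2))"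
      using single[OF m] by (intro sum_bounded_above) auto
    also have "\<dots> \<le> (real m powr (1/3) + 1) * (L / (real m * ?d m * \<eta>\<^sup>2))"
    proof (rule mult_right_mono)
      have "T / ?d m = real m powr (1/3)"
        using T_pos m by (simp add: bin_width_def powr_minus_divide powr_minus field_simps)
      then show "real (card (I m)) \<le> real m powr (1/3) + 1" unfolding I_def by simp
    qed (use L_pos d in simp)
    finally show ?thesis .
  qed
  \<comment> \<open>Up to constants this is m^(1/3) / m^(2/3); any larger number of bins of order at
    least m^(1/2) would break this bound.\<close>
  have lim: "(\<lambda>m. (real m powr (1/3) + 1) * (L / (real m * ?d m * \<eta>\<^sup>2))) \<longlonglongrightarrow> 0"
  proof -
    have "(\<lambda>m. (real m powr (1/3) + 1) / (real m * real m powr (- 1 / 3))) \<longlonglongrightarrow> 0" by real_asymp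
    then have "(\<lambda>m. L / (T * \<eta>\<^sup>2) * ((real m powr (1/3) + 1) / (real m * real m powr (- 1 / 3)))) \<longlonglongrightarrow> 0"
      by (rule tendsto_mult_right_zero)
    moreover have "L / (T * \<eta>\<^sup>2) * ((real m powr (1/3) + 1) / (real m * real m powr (- 1 / 3)))
        = (real m powr (1/3) + 1) * (L / (real m * ?d m * \<eta>\<^sup>2))" for m
      unfolding bin_width_def by (simp only: times_divide_eq_right times_divide_eq_left divide_divide_eq_left ac_simps)
    ultimately show ?thesis by simp
  qed
  show "(\<lambda>m. prob (\<Union>b\<in>I m. E m b)) \<longlonglongrightarrow> 0"
  proof (rule tendsto_sandwich[OF _ _ tendsto_const lim])
    show "\<forall>\<^sub>F m in sequentially. prob (\<Union>b\<in>I m. E m b) \<le> (real m powr (1/3) + 1) * (L / (real m * ?d m * \<eta>\<^sup>2))"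
      using eventually_ge_at_top[of 1] by eventually_elim (rule total)
  qed simp
  fix m \<omega> assume m: "1 \<le> m" and \<omega>: "\<omega> \<in> space P" "\<omega> \<notin> (\<Union>b\<in>I m. E m b)"
  show "\<forall>t\<in>{0..T}. \<bar>intensity_estimate T (data m \<omega>) t - bin_mean m \<lfloor>t / ?d m\<rfloor> / ?d m\<bar> \<le> \<eta>"
  proof
    fix t assume t: "t \<in> {0..T}"
    have d: "0 < ?d m" by (rule bin_width_pos[OF m])
    let ?b = "\<lfloor>t / ?d m\<rfloor>"
    have "?b \<in> I m" unfolding I_def using t d by (auto intro!: floor_mono divide_right_mono)
    then have "\<bar>avg m ?b \<omega> - bin_mean m ?b\<bar> \<le> \<eta> * ?d m" using \<omega> by (auto simp: E_def)
    moreover have "\<bar>avg m ?b \<omega> / ?d m - bin_mean m ?b / ?d m\<bar> = \<bar>avg m ?b \<omega> - bin_mean m ?b\<bar> / ?d m"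
      using d by (simp add: diff_divide_distrib[symmetric] abs_divide)
    ultimately show "\<bar>intensity_estimate T (data m \<omega>) t - bin_mean m ?b / ?d m\<bar> \<le> \<eta>"
      using d unfolding intensity_estimate_data[OF m \<omega>(1)] avg_def by (simp add: divide_le_eq)
  qed
qed

text \<open>The last bin may stick out of \<^term>\<open>{0..T}\<close>, and then the estimate is biased on it. This is why its
  distance to the intensity is controlled by an integrable bound \<open>g\<close> and not uniformly.\<close>

lemma whp_intensity_estimate:
  assumes \<eta>: "0 < \<eta>"
  shows "whp (\<lambda>m \<omega>. \<exists>g I. (g has_integral I) {0..T} \<and> I \<le> \<eta> \<and>
      (\<forall>t\<in>{0..T}. \<bar>intensity_estimate T (data m \<omega>) t - lam t\<bar> \<le> g t))"
proof -
  \<comment> \<open>Chosen so that the integral 2\<gamma>T + \<delta>L of the bound \<open>g\<close>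
    is at most (2T + 1)\<gamma> = \<eta> once \<delta>L < \<gamma>.\<close>
  define \<gamma> where "\<gamma> = \<eta> / (2 * T + 1)"
  have \<gamma>: "0 < \<gamma>" using \<eta> T_pos by (simp add: \<gamma>_def)
  have "uniformly_continuous_on {0..T} lam"
    using lam_cont by (intro compact_uniformly_continuous) auto
  then obtain r where r: "0 < r" "\<And>s t. s \<in> {0..T} \<Longrightarrow> t \<in> {0..T} \<Longrightarrow> \<bar>s - t\<bar> < r \<Longrightarrow> \<bar>lam s - lam t\<bar> < \<gamma>"
    unfolding uniformly_continuous_on_def dist_real_def using \<gamma> by metis
  have "bin_width T \<longlonglongrightarrow> 0" unfolding bin_width_def[abs_def] using T_pos by real_asymp
  then have "\<forall>\<^sub>F m in sequentially. bin_width T m < min r (\<gamma> / L)"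
    using r \<gamma> L_pos by (intro order_tendstoD(2)) auto
  then obtain m1 where m1: "\<And>m. m \<ge> m1 \<Longrightarrow> bin_width T m < r \<and> bin_width T m < \<gamma> / L"
    by (auto simp: eventually_sequentially)
  show ?thesis
  proof (rule whp_mono[OF whp_bin_counts[OF \<gamma>], where ?m0.0 = "max 1 m1"])
    fix m \<omega> assume mm: "max 1 m1 \<le> m" and \<omega>: "\<omega> \<in> space P"
    let ?d = "bin_width T m"
    assume c: "\<forall>t\<in>{0..T}. \<bar>intensity_estimate T (data m \<omega>) t - bin_mean m \<lfloor>t / ?d\<rfloor> / ?d\<bar> \<le> \<gamma>"
    have m: "1 \<le> m" using mm by simp
    have d: "0 < ?d" by (rule bin_width_pos[OF m])
    have dr: "?d < r" "?d * L < \<gamma>" using m1[of m] mm L_pos by (auto simp: pos_less_divide_eq)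
    have dT: "?d \<le> T"
    proof -
      have "real m powr (- 1 / 3) \<le> real m powr 0" using m by (intro powr_mono) auto
      then show ?thesis using m T_pos by (simp add: bin_width_def)
    qed
    \<comment> \<open>In a full bin one \<gamma> pays for the sampling error and one for the
      oscillation of \<open>lam\<close>. Within one width of \<open>T\<close> only the range [0, L]
      of \<open>lam\<close> and of the bin mean per width is used.\<close>
    define g where "g t = 2 * \<gamma> + (if t \<in> {T - ?d..T} then L else 0)" for t
    have "((\<lambda>t. if t \<in> {T - ?d..T} then L else 0) has_integral ?d * L) {0..T}"
      using has_integral_const_real[of L "T - ?d" T] d dT by (subst has_integral_restrict) auto
    from has_integral_add[OF has_integral_const_real[of "2 * \<gamma>" 0 T] this]
    have gi: "(g has_integral T * (2 * \<gamma>) + ?d * L) {0..T}"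
      unfolding g_def[abs_def] using T_pos by simp
    have "T * (2 * \<gamma>) + ?d * L \<le> (2 * T + 1) * \<gamma>" using dr by (simp add: algebra_simps)
    also have "\<dots> = \<eta>" using T_pos by (simp add: \<gamma>_def)
    finally have I: "T * (2 * \<gamma>) + ?d * L \<le> \<eta>" .
    have "\<bar>intensity_estimate T (data m \<omega>) t - lam t\<bar> \<le> g t" if t: "t \<in> {0..T}" for t
    proof (cases "t \<le> T - ?d")
      case True
      have "\<bar>bin_mean m \<lfloor>t / ?d\<rfloor> - ?d * lam t\<bar> \<le> ?d * \<gamma>"
        using r(2)[OF _ t] dr by (intro bin_mean_approx[OF m t True]) (auto intro: less_imp_le)
      moreover have "\<bar>bin_mean m \<lfloor>t / ?d\<rfloor> / ?d - lam t\<bar> = \<bar>bin_mean m \<lfloor>t / ?d\<rfloor> - ?d * lam t\<bar> / ?d"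
      proof -
        have "bin_mean m \<lfloor>t / ?d\<rfloor> / ?d - lam t = (bin_mean m \<lfloor>t / ?d\<rfloor> - ?d * lam t) / ?d"
          using d by (simp add: field_simps)
        then show ?thesis using d by (simp add: abs_divide)
      qed
      ultimately have "\<bar>bin_mean m \<lfloor>t / ?d\<rfloor> / ?d - lam t\<bar> \<le> \<gamma>"
        using d by (simp add: divide_le_eq mult.commute)
      moreover have "2 * \<gamma> \<le> g t" unfolding g_def using L_pos by simp
      ultimately show ?thesis using bspec[OF c t] by linarith
    next
      case False
      have "0 \<le> bin_mean m \<lfloor>t / ?d\<rfloor> / ?d" "bin_mean m \<lfloor>t / ?d\<rfloor> / ?d \<le> L"
        using bin_mean_bounds[OF m, of "\<lfloor>t / ?d\<rfloor>"] d by (auto simp: divide_le_eq)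
      moreover have "0 \<le> lam t" "lam t \<le> L" using lam_pos[OF t] lam_le_L[OF t] by auto
      moreover have "g t = 2 * \<gamma> + L" using False t by (simp add: g_def)
      ultimately show ?thesis using bspec[OF c t] \<gamma> by linarith
    qed
    then show "\<exists>g I. (g has_integral I) {0..T} \<and> I \<le> \<eta> \<and>
        (\<forall>t\<in>{0..T}. \<bar>intensity_estimate T (data m \<omega>) t - lam t\<bar> \<le> g t)"
      using gi I by blast
  qed
qed

end

subsection \<open>Asymptotic optimality\<close>

lemma absolutely_continuous_imp_continuous:
  assumes "absolutely_continuous_on_interval a b g"
  shows "continuous_on {a..b} g"
  unfolding continuous_on_iff dist_real_def
proof (intro ballI allI impI)
  fix x e :: real assume x: "x \<in> {a..b}" and e: "0 < e"
  obtain d where d: "0 < d" and D: "\<And>I :: (real \<times> real) set.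
      finite I \<and> (\<forall>(u, v)\<in>I. a \<le> u \<and> u \<le> v \<and> v \<le> b) \<and>
      pairwise (\<lambda>p q. {fst p<..<snd p} \<inter> {fst q<..<snd q} = {}) I \<and>
      (\<Sum>(u, v)\<in>I. v - u) < d \<Longrightarrow> (\<Sum>(u, v)\<in>I. \<bar>g v - g u\<bar>) < e"
    using assms e unfolding absolutely_continuous_on_interval_def by meson
  have "\<bar>g x' - g x\<bar> < e" if "x' \<in> {a..b}" "\<bar>x' - x\<bar> < d" for x'
    using D[of "{(min x x', max x x')}"] x that
    by (cases "x \<le> x'") (auto simp: abs_minus_commute)
  then show "\<exists>d>0. \<forall>x'\<in>{a..b}. \<bar>x' - x\<bar> < d \<longrightarrow> \<bar>g x' - g x\<bar> < e" using d by blast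
qed

text \<open>\<open>R\<close> is continuous for the topology induced by the coordinates
  \<open>u i\<close>. The set where \<open>a < R\<close> is therefore the preimage of an open set
  \<open>U\<close> of the product space, and the sample is Borel measurable as a point of that space
  because there are countably many coordinates.\<close>

lemma borel_measurable_locally_determined:
  fixes u :: "'i::countable \<Rightarrow> 'a \<Rightarrow> real" and R :: "'a \<Rightarrow> real"
  assumes u: "\<And>i. u i \<in> borel_measurable M"
    and R: "\<And>\<omega> e. \<omega> \<in> space M \<Longrightarrow> 0 < e \<Longrightarrow> \<exists>J d. finite J \<and> 0 < d \<and>
      (\<forall>\<omega>'\<in>space M. (\<forall>i\<in>J. \<bar>u i \<omega>' - u i \<omega>\<bar> < d) \<longrightarrow> \<bar>R \<omega>' - R \<omega>\<bar> < e)"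
  shows "R \<in> borel_measurable M"
  unfolding borel_measurable_iff_greater
proof
  fix a
  define Z where "Z \<omega> = (\<lambda>i. u i \<omega>)" for \<omega>
  have Z: "Z \<in> measurable M borel"
    unfolding Z_def[abs_def] using u by (rule measurable_coordinatewise_then_product)
  define U where "U = \<Union>{V. open V \<and> (\<forall>\<omega>\<in>space M. Z \<omega> \<in> V \<longrightarrow> a < R \<omega>)}"
  have "open U" unfolding U_def by auto
  then have "Z -` U \<inter> space M \<in> sets M" using Z by (intro measurable_sets) auto
  moreover have "{\<omega> \<in> space M. a < R \<omega>} = Z -` U \<inter> space M"
  proof
    show "Z -` U \<inter> space M \<subseteq> {\<omega> \<in> space M. a < R \<omega>}" by (auto simp: U_def)
    show "{\<omega> \<in> space M. a < R \<omega>} \<subseteq> Z -` U \<inter> space M"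
    proof
      fix \<omega> assume "\<omega> \<in> {\<omega> \<in> space M. a < R \<omega>}"
      then have \<omega>: "\<omega> \<in> space M" "0 < R \<omega> - a" by auto
      obtain J d where J: "finite J" "0 < d" and
        near: "\<forall>\<omega>'\<in>space M. (\<forall>i\<in>J. \<bar>u i \<omega>' - u i \<omega>\<bar> < d) \<longrightarrow> \<bar>R \<omega>' - R \<omega>\<bar> < R \<omega> - a"
        using R[OF \<omega>] by (elim exE conjE) (rule that)
      let ?V = "\<Inter>i\<in>J. (\<lambda>v. v i) -` ball (u i \<omega>) d"
      have "open ?V"
        using J(1) by (intro open_INT ballI open_vimage continuous_on_product_coordinates) auto
      moreover have "a < R \<omega>'" if "\<omega>' \<in> space M" "Z \<omega>' \<in> ?V" for \<omega>'
      proof -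
        have "\<forall>i\<in>J. \<bar>u i \<omega>' - u i \<omega>\<bar> < d" using that(2) by (auto simp: Z_def dist_real_def abs_minus_commute)
        then have "\<bar>R \<omega>' - R \<omega>\<bar> < R \<omega> - a" using near that(1) by simp
        then show ?thesis by linarith
      qed
      moreover have "Z \<omega> \<in> ?V" using J(2) by (simp add: Z_def)
      ultimately show "\<omega> \<in> Z -` U \<inter> space M" using \<omega>(1) unfolding U_def by blast
    qed
  qed
  ultimately show "{\<omega> \<in> space M. a < R \<omega>} \<in> sets M" by simp
qed

context npsa_sample
begin

lemma intensity_estimate_nonneg: "1 \<le> m \<Longrightarrow> \<omega> \<in> space P \<Longrightarrow> 0 \<le> intensity_estimate T (data m \<omega>) t"
  using bin_width_pos[of m] by (simp add: intensity_estimate_data sum_nonneg)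

lemma intensity_estimate_le:
  assumes "1 \<le> m" "\<omega> \<in> space P"
  shows "intensity_estimate T (data m \<omega>) t \<le> (\<Sum>i<m. real (K i \<omega>)) / real m / bin_width T m"
proof -
  have "arrivals_in B (K i) (A i) \<omega> \<le> K i \<omega>" for B i
  proof -
    have "arrivals_in B (K i) (A i) \<omega> \<le> card {..<K i \<omega>}"
      unfolding arrivals_in_def by (intro card_mono) auto
    then show ?thesis by simp
  qed
  then show ?thesis
    unfolding intensity_estimate_data[OF assms] using bin_width_pos[OF assms(1)]
    by (intro divide_right_mono sum_mono) auto
qed

definition discontinuities :: "nat \<Rightarrow> 'w \<Rightarrow> real set" where
  "discontinuities m \<omega> = {t\<in>{0..T}. \<not> continuous (at t within {0..T}) (intensity_estimate T (data m \<omega>))}"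

text \<open>The estimate is constant in the interior of each bin, so only left ends of bins can be
  discontinuities. Finiteness of the exceptional set is what the stability lemma asks for.\<close>

lemma finite_discontinuities:
  assumes m: "1 \<le> m"
  shows "finite (discontinuities m \<omega>)"
proof (rule finite_subset)
  let ?d = "bin_width T m"
  have d: "0 < ?d" by (rule bin_width_pos[OF m])
  show "discontinuities m \<omega> \<subseteq> (\<lambda>b. of_int b * ?d) ` {0..\<lfloor>T / ?d\<rfloor>}"
  proof
    fix t assume t: "t \<in> discontinuities m \<omega>"
    let ?b = "\<lfloor>t / ?d\<rfloor>"
    have t0: "0 \<le> t" "t \<le> T" using t by (auto simp: discontinuities_def)
    then have b: "?b \<in> {0..\<lfloor>T / ?d\<rfloor>}" using d by (auto intro!: floor_mono divide_right_mono)
    have tb: "of_int ?b * ?d \<le> t" "t < of_int ?b * ?d + ?d" using floor_divide_eq[OF d, of t ?b] by auto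
    have "t = of_int ?b * ?d"
    proof (rule ccontr)
      assume "t \<noteq> of_int ?b * ?d"
      with tb have in_bin: "t \<in> {of_int ?b * ?d<..<of_int ?b * ?d + ?d}" by auto
      have "intensity_estimate T (data m \<omega>) s = intensity_estimate T (data m \<omega>) t"
        if "s \<in> {of_int ?b * ?d<..<of_int ?b * ?d + ?d}" for s
      proof -
        have "\<lfloor>s / ?d\<rfloor> = ?b" using that floor_divide_eq[OF d, of s ?b] by auto
        then show ?thesis by (simp add: intensity_estimate_def bin_start_def data_def)
      qed
      then have "\<forall>\<^sub>F s in at t within {0..T}. intensity_estimate T (data m \<omega>) s = intensity_estimate T (data m \<omega>) t"
        unfolding eventually_at_topological using in_bin
        by (intro exI[of _ "{of_int ?b * ?d<..<of_int ?b * ?d + ?d}"] conjI open_greaterThanLessThan ballI impI)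
          (assumption | blast)+
      then have "continuous (at t within {0..T}) (intensity_estimate T (data m \<omega>))"
        unfolding continuous_within by (rule tendsto_eventually)
      then show False using t by (simp add: discontinuities_def)
    qed
    then show "t \<in> (\<lambda>b. of_int b * ?d) ` {0..\<lfloor>T / ?d\<rfloor>}" using b by blast
  qed
qed simp

lemma npsa_curves_imp_curves:
  assumes "npsa_curves T rs n z"
  shows "curves z"
  using assms absolutely_continuous_imp_continuous
  by (auto simp: curves_def npsa_curves_def solves_curve_equations_def)

lemma npsa_curves_solve:
  assumes "npsa_curves T (data m \<omega>) n z"
  shows "solves_curve_equations T (discontinuities m \<omega>) (intensity_estimate T (data m \<omega>))
    (mean_shortage_estimate (data m \<omega>)) n z"
  using assms by (simp add: npsa_curves_def discontinuities_def)

text \<open>The true problem is the reference system, since its intensity is bounded by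
  \<open>L\<close> whatever the sample.\<close>

lemma npsa_curves_near_optimal:
  assumes m: "1 \<le> m" and y: "optimal_critical_curves T lam f n y" and z: "npsa_curves T (data m \<omega>) n z"
    and \<phi>: "\<And>a. 0 \<le> a \<Longrightarrow> \<bar>mean_shortage_estimate (data m \<omega>) a - mean_shortage f a\<bar> \<le> \<eta>"
    and g: "(g has_integral I) {0..T}" "\<And>t. t \<in> {0..T} \<Longrightarrow> \<bar>intensity_estimate T (data m \<omega>) t - lam t\<bar> \<le> g t"
    and I: "I \<le> \<eta>" and \<eta>: "0 \<le> \<eta>" "\<eta> \<le> 1" and k: "k \<in> {1..n}" and t: "t \<in> {0..T}"
  shows "\<bar>z k t - y k t\<bar> \<le> \<eta> * ((\<mu> + 1 + 2 * (L * T)) * (\<Sum>j<n. (L * T) ^ j))"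
proof -
  have LT: "0 \<le> L * T" using L_pos T_pos by simp
  have cy: "curves y" by (rule optimal_value_positive(1)[OF y])
  have cz: "curves z" by (rule npsa_curves_imp_curves[OF z])
  \<comment> \<open>The sample-free bound C = \<mu> + 1 comes from \<phi> \<le> \<phi>(0) = \<mu>
    and \<eta> \<le> 1.\<close>
  have bd: "0 \<le> mean_shortage_estimate (data m \<omega>) a \<and> mean_shortage_estimate (data m \<omega>) a \<le> \<mu> + 1" if "0 \<le> a" for a
    using \<phi>[OF that] \<eta>(2) mean_shortage_antimono[OF that] mean_shortage_0
      mean_shortage_estimate_nonneg[of "data m \<omega>" a] by auto
  have "\<bar>y k t - z k t\<bar> \<le> ((\<mu> + 1) * I + 2 * (L * T) * \<eta>) * (\<Sum>j<k. (L * T) ^ j)"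
  proof (rule curve_equations_stable[OF _ _ _ _ npsa_curves_solve[OF z] _ finite_discontinuities[OF m]])
    show "solves_curve_equations T {} lam (mean_shortage f) n y"
      using y by (simp add: optimal_critical_curves_def)
    show "0 \<le> lam t \<and> lam t \<le> L" if "t \<in> {0..T}" for t
      using lam_pos[OF that] lam_le_L[OF that] by simp
  qed (use T_pos cy cz mean_shortage_antimono mean_shortage_lipschitz \<phi> bd g k t in \<open>auto simp: curves_def\<close>)
  also have "\<dots> \<le> ((\<mu> + 1) * \<eta> + 2 * (L * T) * \<eta>) * (\<Sum>j<n. (L * T) ^ j)"
    using LT k \<eta>(1) I D_mean(2)
    by (intro mult_mono add_mono sum_mono2 mult_left_mono add_nonneg_nonneg sum_nonneg) auto
  also have "\<dots> = \<eta> * ((\<mu> + 1 + 2 * (L * T)) * (\<Sum>j<n. (L * T) ^ j))" by (simp add: algebra_simps)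
  finally show ?thesis by (simp add: abs_minus_commute)
qed

section \<open>Measurability of the reward in the sample\<close>

text \<open>Equal job counts and bin indices leave the intensity estimate unchanged, so only the job
  values move the curves. Both systems are empirical; the reference is the one at \<omega>, and
  \<open>q\<close> is the sample-dependent bound on its intensity times \<open>T\<close>.\<close>

lemma npsa_curves_continuous_in_data:
  assumes m: "1 \<le> m" and \<omega>: "\<omega> \<in> space P" "\<omega>' \<in> space P"
    and w: "npsa_curves T (data m \<omega>) n w" and z: "npsa_curves T (data m \<omega>') n z"
    and K: "\<And>i. i < m \<Longrightarrow> K i \<omega>' = K i \<omega>"
    and A: "\<And>i j. i < m \<Longrightarrow> j < K i \<omega> \<Longrightarrow> \<lfloor>A i j \<omega>' / bin_width T m\<rfloor> = \<lfloor>A i j \<omega> / bin_width T m\<rfloor>"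
    and X: "\<And>i j. i < m \<Longrightarrow> j < K i \<omega> \<Longrightarrow> \<bar>X i j \<omega>' - X i j \<omega>\<bar> \<le> \<eta>"
    and \<eta>: "0 \<le> \<eta>" and k: "k \<in> {1..n}" and t: "t \<in> {0..T}"
  defines "q \<equiv> (\<Sum>i<m. real (K i \<omega>)) / real m / bin_width T m * T"
  shows "\<bar>z k t - w k t\<bar> \<le> \<eta> * (2 * q * (\<Sum>j<n. q ^ j))"
proof -
  have d: "0 < bin_width T m" by (rule bin_width_pos[OF m])
  have q: "0 \<le> q" unfolding q_def using d T_pos by (simp add: sum_nonneg)
  have cw: "curves w" and cz: "curves z" using npsa_curves_imp_curves w z by auto
  have "arrivals_in (bin m b) (K i) (A i) \<omega>' = arrivals_in (bin m b) (K i) (A i) \<omega>" if i: "i < m" for b i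
    unfolding arrivals_in_def bin_def using K[OF i] A[OF i] arrival_times[OF \<omega>(1)] arrival_times[OF \<omega>(2)]
    by (intro arg_cong[where f = card]) auto
  then have \<lambda>: "intensity_estimate T (data m \<omega>') t = intensity_estimate T (data m \<omega>) t" for t
    unfolding intensity_estimate_data[OF m \<omega>(1)] intensity_estimate_data[OF m \<omega>(2)] by simp
  have one: "pooled_average (\<lambda>_. 1) m \<omega>' = pooled_average (\<lambda>_. 1) m \<omega>"
    using K by (simp add: pooled_average_def)
  have \<phi>: "\<bar>mean_shortage_estimate (data m \<omega>') a - mean_shortage_estimate (data m \<omega>) a\<bar> \<le> \<eta>" for a
  proof -
    let ?h = "\<lambda>x. max (x - a) 0" and ?N = "pooled_average (\<lambda>_. 1) m \<omega>"
    have N0: "0 \<le> ?N" by (simp add: pooled_average_def sum_nonneg)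
    have "(\<Sum>i<m. \<Sum>j<K i \<omega>'. ?h (X i j \<omega>')) = (\<Sum>i<m. \<Sum>j<K i \<omega>. ?h (X i j \<omega>'))"
      using K by simp
    then have "\<bar>(\<Sum>i<m. \<Sum>j<K i \<omega>'. ?h (X i j \<omega>')) - (\<Sum>i<m. \<Sum>j<K i \<omega>. ?h (X i j \<omega>))\<bar>
        = \<bar>\<Sum>i<m. \<Sum>j<K i \<omega>. ?h (X i j \<omega>') - ?h (X i j \<omega>)\<bar>"
      by (simp add: sum_subtractf)
    also have "\<dots> \<le> (\<Sum>i<m. \<Sum>j<K i \<omega>. \<bar>?h (X i j \<omega>') - ?h (X i j \<omega>)\<bar>)"
      by (intro order_trans[OF sum_abs] sum_mono sum_abs)
    also have "\<dots> \<le> (\<Sum>i<m. \<Sum>j<K i \<omega>. \<eta>)"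
    proof (intro sum_mono)
      fix i j assume "i \<in> {..<m}" "j \<in> {..<K i \<omega>}"
      then show "\<bar>?h (X i j \<omega>') - ?h (X i j \<omega>)\<bar> \<le> \<eta>" using X[of i j] by auto
    qed
    finally have "\<bar>pooled_average ?h m \<omega>' - pooled_average ?h m \<omega>\<bar> \<le> \<eta> * ?N"
      using m by (simp add: pooled_average_def diff_divide_distrib[symmetric] abs_divide divide_right_mono
          sum_distrib_left[symmetric] mult.commute)
    then show ?thesis
      unfolding mean_shortage_estimate_data[OF m] one diff_divide_distrib[symmetric] abs_divide
      \<comment> \<open>Without any job both quotients are 0 by the convention on division by
        0.\<close>
      using N0 \<eta> by (cases "?N = 0") (auto simp: divide_le_eq)
  qed
  \<comment> \<open>The bound C on the second shortage function is its value at 0; it may depend on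
    \<omega>' because it is multiplied by I = 0.\<close>
  have "\<bar>w k t - z k t\<bar> \<le> (mean_shortage_estimate (data m \<omega>') 0 * 0
      + 2 * ((\<Sum>i<m. real (K i \<omega>)) / real m / bin_width T m * T) * \<eta>) * (\<Sum>j<k. ((\<Sum>i<m. real (K i \<omega>)) / real m / bin_width T m * T) ^ j)"
  proof (rule curve_equations_stable[OF _ npsa_curves_solve[OF w] _ finite_discontinuities[OF m]
        npsa_curves_solve[OF z] _ finite_discontinuities[OF m], where g = "\<lambda>_. 0"])
    show "0 \<le> intensity_estimate T (data m \<omega>) t \<and>
        intensity_estimate T (data m \<omega>) t \<le> (\<Sum>i<m. real (K i \<omega>)) / real m / bin_width T m" for t
      using intensity_estimate_nonneg[OF m \<omega>(1)] intensity_estimate_le[OF m \<omega>(1)] by blast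
    show "\<bar>intensity_estimate T (data m \<omega>') t - intensity_estimate T (data m \<omega>) t\<bar> \<le> 0" for t
      using \<lambda> by simp
    show "\<bar>mean_shortage_estimate (data m \<omega>') a - mean_shortage_estimate (data m \<omega>) a\<bar> \<le> \<eta>" for a by (rule \<phi>)
  qed (use T_pos cw cz mean_shortage_estimate_antimono mean_shortage_estimate_nonneg
      mean_shortage_estimate_lipschitz k t in \<open>auto simp: curves_def\<close>)
  also have "\<dots> = \<eta> * (2 * q * (\<Sum>j<k. q ^ j))" by (simp add: q_def)
  also have "\<dots> \<le> \<eta> * (2 * q * (\<Sum>j<n. q ^ j))"
    using k q \<eta> by (intro mult_left_mono sum_mono2) auto
  finally show ?thesis by (simp add: abs_minus_commute)
qed

text \<open>The curves are given only as solutions, sample by sample. Stability makes the reward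
  locally determined by finitely many measurable coordinates, and this yields measurability.\<close>

lemma value_of_npsa_measurable:
  assumes m: "1 \<le> m" and z: "\<And>\<omega>. \<omega> \<in> space P \<Longrightarrow> npsa_curves T (data m \<omega>) n (z \<omega>)"
  shows "(\<lambda>\<omega>. value_of (z \<omega>)) \<in> borel_measurable P"
proof -
  \<comment> \<open>The first index selects job values, bin indices or job counts. The last two are
    integers, so being closer than 1 means being equal; arrival times themselves would not do, since
    the estimate jumps at bin ends.\<close>
  define u :: "nat \<times> nat \<times> nat \<Rightarrow> 'w \<Rightarrow> real" where
    "u = (\<lambda>(c, i, j) \<omega>. if c = 0 then X i j \<omega> else if c = 1 then of_int \<lfloor>A i j \<omega> / bin_width T m\<rfloor> else real (K i \<omega>))"
  have integer: "a = b" if "\<bar>real_of_int a - of_int b\<bar> < d" "d \<le> 1" for a b d using that by linarith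
  show ?thesis
  proof (rule borel_measurable_locally_determined)
    show "u p \<in> borel_measurable P" for p
      by (cases p) (auto simp: u_def)
    fix \<omega> and e :: real assume \<omega>: "\<omega> \<in> space P" and e: "0 < e"
    obtain d where d: "0 < d" and cont: "\<And>v. curves v \<Longrightarrow>
        (\<And>i t. i \<in> {1..n} \<Longrightarrow> t \<in> {0..T} \<Longrightarrow> \<bar>v i t - z \<omega> i t\<bar> \<le> d) \<Longrightarrow> \<bar>value_of v - value_of (z \<omega>)\<bar> < e"
      using value_of_continuous[OF npsa_curves_imp_curves[OF z[OF \<omega>]] e] by blast
    define q where "q = (\<Sum>i<m. real (K i \<omega>)) / real m / bin_width T m * T"
    have q: "0 \<le> q" unfolding q_def using bin_width_pos[OF m] T_pos by (simp add: sum_nonneg)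
    define B where "B = 2 * q * (\<Sum>j<n. q ^ j)"
    have B: "0 \<le> B" unfolding B_def using q by (simp add: sum_nonneg)
    \<comment> \<open>The 1 forces integer coordinates to agree; the quotient keeps the curves
      within \<open>d\<close>.\<close>
    define \<eta> where "\<eta> = min 1 (d / (B + 1))"
    have \<eta>: "0 < \<eta>" unfolding \<eta>_def using d B by simp
    have "\<eta> * B \<le> d / (B + 1) * (B + 1)" unfolding \<eta>_def using d B by (intro mult_mono) auto
    then have \<eta>B: "\<eta> * B \<le> d" using B by simp
    \<comment> \<open>The neighbourhood may depend on \<omega>; the total number of jobs bounds all
      relevant job indices of all \<open>m\<close> realisations at once.\<close>
    define J where "J = {..<3::nat} \<times> {..<m} \<times> {..(\<Sum>i<m. K i \<omega>)}"
    have J: "(c, i, j) \<in> J" if "c < 3" "i < m" "j \<le> K i \<omega>" for c i j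
    proof -
      have "K i \<omega> \<le> (\<Sum>i<m. K i \<omega>)" using that by (intro member_le_sum) auto
      then show ?thesis using that by (simp add: J_def)
    qed
    have "\<bar>value_of (z \<omega>') - value_of (z \<omega>)\<bar> < e"
      if \<omega>': "\<omega>' \<in> space P" and near: "\<forall>p\<in>J. \<bar>u p \<omega>' - u p \<omega>\<bar> < \<eta>" for \<omega>'
    proof (rule cont[OF npsa_curves_imp_curves[OF z[OF \<omega>']]])
      fix k t assume k: "k \<in> {1..n}" and t: "t \<in> {0..T}"
      have "\<bar>z \<omega>' k t - z \<omega> k t\<bar> \<le> \<eta> * (2 * q * (\<Sum>j<n. q ^ j))"
        unfolding q_def
      proof (rule npsa_curves_continuous_in_data[OF m \<omega> \<omega>' z[OF \<omega>] z[OF \<omega>'] _ _ _ less_imp_le[OF \<eta>] k t])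
        fix i assume i: "i < m"
        show "K i \<omega>' = K i \<omega>"
          using bspec[OF near J[of 2 i 0]] i integer[of "int (K i \<omega>')" "int (K i \<omega>)" \<eta>]
          by (simp add: u_def \<eta>_def)
        fix j assume j: "j < K i \<omega>"
        show "\<lfloor>A i j \<omega>' / bin_width T m\<rfloor> = \<lfloor>A i j \<omega> / bin_width T m\<rfloor>"
          using bspec[OF near J[of 1 i j]] i j by (intro integer[of _ _ \<eta>]) (auto simp: u_def \<eta>_def)
        show "\<bar>X i j \<omega>' - X i j \<omega>\<bar> \<le> \<eta>"
          using bspec[OF near J[of 0 i j]] i j by (auto simp: u_def)
      qed
      then show "\<bar>z \<omega>' k t - z \<omega> k t\<bar> \<le> d" using \<eta>B unfolding B_def by linarith
    qed
    then show "\<exists>J d. finite J \<and> 0 < d \<and>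
        (\<forall>\<omega>'\<in>space P. (\<forall>p\<in>J. \<bar>u p \<omega>' - u p \<omega>\<bar> < d) \<longrightarrow> \<bar>value_of (z \<omega>') - value_of (z \<omega>)\<bar> < e)"
      using \<eta> by (intro exI[of _ J] exI[of _ \<eta>]) (auto simp: J_def)
  qed
qed

lemma whp_npsa_near_optimal:
  assumes y: "optimal_critical_curves T lam f n y"
    and z: "\<And>m \<omega>. 1 \<le> m \<Longrightarrow> \<omega> \<in> space P \<Longrightarrow> npsa_curves T (data m \<omega>) n (z m \<omega>)" and d: "0 < d"
  shows "whp (\<lambda>m \<omega>. \<forall>k\<in>{1..n}. \<forall>t\<in>{0..T}. \<bar>z m \<omega> k t - y k t\<bar> \<le> d)"
proof -
  define B where "B = (\<mu> + 1 + 2 * (L * T)) * (\<Sum>j<n. (L * T) ^ j)"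
  have B: "0 \<le> B" unfolding B_def using L_pos T_pos D_mean(2) by (simp add: sum_nonneg)
  \<comment> \<open>The 1 is the cap under which the estimated shortage stays below \<mu> + 1; the
    quotient brings the stability bound down to \<open>d\<close>.\<close>
  define \<eta> where "\<eta> = min 1 (d / (B + 1))"
  have \<eta>: "0 < \<eta>" unfolding \<eta>_def using d B by simp
  have "\<eta> * B \<le> d / (B + 1) * (B + 1)" unfolding \<eta>_def using d B by (intro mult_mono) auto
  then have \<eta>B: "\<eta> * B \<le> d" using B by simp
  show ?thesis
  proof (rule whp_mono[OF whp_conj[OF whp_mean_shortage_estimate_uniform[OF \<eta>] whp_intensity_estimate[OF \<eta>]],
        where ?m0.0 = 1], elim conjE exE, intro ballI)
    fix m \<omega> g I k t
    assume m: "1 \<le> m" and \<omega>: "\<omega> \<in> space P"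
      and \<phi>: "\<forall>a\<ge>0. \<bar>mean_shortage_estimate (data m \<omega>) a - mean_shortage f a\<bar> \<le> \<eta>"
      and g: "(g has_integral I) {0..T}" and I: "I \<le> \<eta>"
      and \<lambda>: "\<forall>t\<in>{0..T}. \<bar>intensity_estimate T (data m \<omega>) t - lam t\<bar> \<le> g t"
      and k: "k \<in> {1..n}" and t: "t \<in> {0..T}"
    have "\<bar>z m \<omega> k t - y k t\<bar> \<le> \<eta> * ((\<mu> + 1 + 2 * (L * T)) * (\<Sum>j<n. (L * T) ^ j))"
      by (rule npsa_curves_near_optimal[OF m y z[OF m \<omega>] _ g _ I _ _ k t]) (use \<phi> \<lambda> \<eta> in \<open>auto simp: \<eta>_def\<close>)
    then show "\<bar>z m \<omega> k t - y k t\<bar> \<le> d" using \<eta>B unfolding B_def by linarith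
  qed
qed

lemma npsa_asymptotically_optimal:
  assumes y: "optimal_critical_curves T lam f n y"
    and z: "\<And>m \<omega>. 1 \<le> m \<Longrightarrow> \<omega> \<in> space P \<Longrightarrow> npsa_curves T (data m \<omega>) n (z m \<omega>)" and \<epsilon>: "0 < \<epsilon>"
  shows "(\<lambda>m. prob {\<omega> \<in> space P. 1 - \<epsilon> \<le> value_of (z m \<omega>) / value_of y}) \<longlonglongrightarrow> 1"
proof (rule whp_event[where ?m0.0 = 1])
  note y_curves = optimal_value_positive(1)[OF y] and y_pos = optimal_value_positive(2)[OF y]
  show "{\<omega> \<in> space P. 1 - \<epsilon> \<le> value_of (z m \<omega>) / value_of y} \<in> events" if "1 \<le> m" for m
    using value_of_npsa_measurable[OF that z[OF that]] by measurable
  obtain d where d: "0 < d" and cont: "\<And>v. curves v \<Longrightarrow>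
      \<forall>i\<in>{1..n}. \<forall>t\<in>{0..T}. \<bar>v i t - y i t\<bar> \<le> d \<Longrightarrow> \<bar>value_of v - value_of y\<bar> < \<epsilon> * value_of y"
    using value_of_continuous[OF y_curves mult_pos_pos[OF \<epsilon> y_pos]] by blast
  show "whp (\<lambda>m \<omega>. 1 - \<epsilon> \<le> value_of (z m \<omega>) / value_of y)"
  proof (rule whp_mono[OF whp_npsa_near_optimal[OF y z d], where ?m0.0 = 1])
    fix m \<omega> assume m: "1 \<le> m" "\<omega> \<in> space P" and near: "\<forall>k\<in>{1..n}. \<forall>t\<in>{0..T}. \<bar>z m \<omega> k t - y k t\<bar> \<le> d"
    have "\<bar>value_of (z m \<omega>) - value_of y\<bar> < \<epsilon> * value_of y"
      using cont[OF npsa_curves_imp_curves[OF z[OF m]] near] .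
    then have "(1 - \<epsilon>) * value_of y \<le> value_of (z m \<omega>)" by (simp add: algebra_simps abs_less_iff)
    then show "1 - \<epsilon> \<le> value_of (z m \<omega>) / value_of y" using y_pos by (simp add: pos_le_divide_eq)
  qed
qed

end

theorem theorem4:
  fixes T \<epsilon> :: real and n :: nat and lam f :: "real \<Rightarrow> real" and D :: "real measure"
    and P :: "'w measure"
    and K :: "nat \<Rightarrow> 'w \<Rightarrow> nat" and X A :: "nat \<Rightarrow> nat \<Rightarrow> 'w \<Rightarrow> real"
    and y :: "nat \<Rightarrow> real \<Rightarrow> real" and yt :: "nat \<Rightarrow> 'w \<Rightarrow> nat \<Rightarrow> real \<Rightarrow> real"
  assumes "0 < T" and "1 \<le> n"
    and "continuous_on {0..T} lam" and "\<And>t. t \<in> {0..T} \<Longrightarrow> 0 < lam t"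
    and "f \<in> borel_measurable borel" and "\<And>x. 0 \<le> f x" and "bounded (range f)"
    and "real_distribution D" and "D = density lborel (\<lambda>x. ennreal (f x))"
    and "AE x in D. 0 \<le> x"
    and "integrable D (\<lambda>x. x)" and "0 < (\<integral>x. x \<partial>D)"
    and "prob_space P"
    and "independent_realisations P T lam D K X A"
    and "optimal_critical_curves T lam f n y"
    and "\<And>M \<omega>. 1 \<le> M \<Longrightarrow> \<omega> \<in> space P \<Longrightarrow>
      npsa_curves T (map (\<lambda>i. job_list (K i) (X i) (A i) \<omega>) [0..<M]) n (yt M \<omega>)"
    and "0 < \<epsilon>" and "\<epsilon> < 1"
  shows "(\<lambda>M. \<P>(\<omega> in P.
      expected_reward T lam (cdf D) f (yt M \<omega>) n 0 / expected_reward T lam (cdf D) f y n 0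
        \<ge> 1 - \<epsilon>)) \<longlonglongrightarrow> 1"
proof -
  interpret job_value_law D f
    by (rule job_value_law.intro) (fact assms)+
  interpret npsa_setting D f T n lam
    by (unfold_locales) (fact assms)+
  interpret prob_space P by (fact assms)
  interpret npsa_sample D f T n lam P K X A
    by (unfold_locales) (fact assms)
  show ?thesis
  proof (rule npsa_asymptotically_optimal)
    show "npsa_curves T (data m \<omega>) n (yt m \<omega>)" if "1 \<le> m" "\<omega> \<in> space P" for m \<omega>
      unfolding data_def by (rule assms(16)[OF that])
  qed (fact assms)+
qed

end
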